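(* Let $\mathcal{G}=(G^0,\mathcal{G}^1,r,s)$ be an ultragraph and let $R$ be a nonzero unital commutative ring. Then the Leavitt path algebra $L_R(\mathcal{G})$, with its $\mathbb{Z}$-grading $\{L_R(\mathcal{G})_n\}_{n\in\mathbb{Z}}$, is strongly $\mathbb{Z}$-graded if and only if no vertex of $\mathcal{G}$ is a sink, $\mathcal{G}$ is row-finite, and $\mathcal{G}$ satisfies Condition (Y).
   Context: An ultragraph $\mathcal{G}=(G^0,\mathcal{G}^1,r,s)$ consists of two countable sets $G^0$ (vertices) and $\mathcal{G}^1$ (edges), a map $s:\mathcal{G}^1\to G^0$ and a map $r:\mathcal{G}^1\to P(G^0)\setminus\{\emptyset\}$, where $P(G^0)$ is the power set of $G^0$. $\mathcal{G}^0$ (the set of generalized vertices) is the smallest subset of $P(G^0)$ that contains $\{v\}$ for all $v\in G^0$, contains $r(e)$ for all $e\in\mathcal{G}^1$, and is closed under finite unions and non-empty finite intersections. For a unital commutative ring $R$, $L_R(\mathcal{G})$ is the universal $R$-algebra with generators $\{s_e,s_e^*:e\in\mathcal{G}^1\}\cup\{p_A:A\in\mathcal{G}^0\}$ and relations: (1) $p_\emptyset=0$, $p_Ap_B=p_{A\cap B}$, $p_{A\cup B}=p_A+p_B-p_{A\cap B}$ for all $A,B\in\mathcal{G}^0$; (2) $p_{s(e)}s_e=s_ep_{r(e)}=s_e$ and $p_{r(e)}s_e^*=s_e^*p_{s(e)}=s_e^*$ for all $e\in\mathcal{G}^1$; (3) $s_e^*s_f=\delta_{e,f}p_{r(e)}$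 for all $e,f\in\mathcal{G}^1$; (4) $p_v=\sum_{s(e)=v}s_es_e^*$ whenever $0<|s^{-1}(v)|<\infty$. Here $p_v$ means $p_{\{v\}}$. A finite path is either an element of $\mathcal{G}^0$ (of length $0$) or a sequence of edges $e_1\cdots e_n$ (of length $n$) with $s(e_{i+1})\in r(e_i)$ for $1\le i<n$; $\mathcal{G}^*$ is the set of finite paths. For $\alpha=e_1\cdots e_n$, $r(\alpha)=r(e_n)$, $s_\alpha=s_{e_1}\cdots s_{e_n}$, $s_\alpha^*=s_{e_n}^*\cdots s_{e_1}^*$; for a length-zero path $A\in\mathcal{G}^0$, $r(A)=A$ and $s_A=s_A^*=p_A$. An infinite path is a sequence $e_1e_2e_3\cdots$ of edges with $s(e_{i+1})\in r(e_i)$ for all $i\geq 1$. The $\mathbb{Z}$-grading: $L_R(\mathcal{G})_m$ is the set of finite sums $\sum_i\lambda_is_{\alpha_i}p_{A_i}s_{\beta_i}^*$ with $\lambda_i\in R$, $\alpha_i,\beta_i\in\mathcal{G}^*$, $A_i\in\mathcal{G}^0$, $|\alpha_i|-|\beta_i|=m$. A grading $T=\bigoplus_nT_n$ is strong if $T_mT_n=T_{m+n}$ for all $m,n\in\mathbb{Z}$, where $T_mT_n$ denotes the set of finite sums of products. A vertex $v$ is a sink if $s^{-1}(v)=\emptyset$, and an infinite emitter if $|s^{-1}(v)|=\infty$. $\mathcal{G}$ is row-finite if $r(e)$ is finite for every $e\in\mathcal{G}^1$ and no vertex is an infinite emitter. $\mathcal{G}$ satisfies Condition (Y) if for each infinite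 path $e_1e_2e_3\cdots$ there exist $k\in\mathbb{N}$ and a finite path $\alpha\in\mathcal{G}^*$ with $|\alpha|=k+1$ and $s(e_{k+1})\in r(\alpha)$. *)

theory Defs
  imports "HOL-Library.Countable_Set" "HOL-Library.Poly_Mapping" "HOL-Algebra.QuotRing"
begin

section \<open>Ultragraphs\<close>

record ('v, 'e) pre_ultragraph =
  verts :: "'v set"
  edges :: "'e set"
  src :: "'e \<Rightarrow> 'v"
  rng :: "'e \<Rightarrow> 'v set"

locale ultragraph =
  fixes G :: "('v, 'e) pre_ultragraph"
  assumes countable_verts: "countable (verts G)"
    and countable_edges: "countable (edges G)"
    and src_in_verts: "e \<in> edges G \<Longrightarrow> src G e \<in> verts G"
    and rng_subset_verts: "e \<in> edges G \<Longrightarrow> rng G e \<subseteq> verts G"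
    and rng_nonempty: "e \<in> edges G \<Longrightarrow> rng G e \<noteq> {}"

text \<open>
  The empty set is the empty finite union; it has to be a generalized vertex because
  one of the relations below is \<open>p {} = 0\<close>.
\<close>

inductive_set gverts :: "('v, 'e) pre_ultragraph \<Rightarrow> 'v set set"
  for G :: "('v, 'e) pre_ultragraph"
where
  empty: "{} \<in> gverts G"
| vertex: "v \<in> verts G \<Longrightarrow> {v} \<in> gverts G"
| rng: "e \<in> edges G \<Longrightarrow> rng G e \<in> gverts G"
| union: "A \<in> gverts G \<Longrightarrow> B \<in> gverts G \<Longrightarrow> A \<union> B \<in> gverts G"
| inter: "A \<in> gverts G \<Longrightarrow> B \<in> gverts G \<Longrightarrow> A \<inter> B \<in> gverts G"

datatype ('v, 'e) upath = GVert "'v set" | EPath "'e list"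

fun is_path :: "('v, 'e) pre_ultragraph \<Rightarrow> ('v, 'e) upath \<Rightarrow> bool" where
  "is_path G (GVert A) \<longleftrightarrow> A \<in> gverts G"
| "is_path G (EPath es) \<longleftrightarrow> es \<noteq> [] \<and> set es \<subseteq> edges G \<and>
     (\<forall>i. Suc i < length es \<longrightarrow> src G (es ! Suc i) \<in> rng G (es ! i))"

definition paths :: "('v, 'e) pre_ultragraph \<Rightarrow> ('v, 'e) upath set" where
  "paths G = {\<alpha>. is_path G \<alpha>}"

fun path_length :: "('v, 'e) upath \<Rightarrow> nat" where
  "path_length (GVert A) = 0"
| "path_length (EPath es) = length es"

fun path_rng :: "('v, 'e) pre_ultragraph \<Rightarrow> ('v, 'e) upath \<Rightarrow> 'v set" where
  "path_rng G (GVert A) = A"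
| "path_rng G (EPath es) = rng G (last es)"

text \<open>An infinite path \<open>e\<^sub>1e\<^sub>2e\<^sub>3\<dots>\<close> is indexed from 0, so \<open>e\<^sub>k\<^sub>+\<^sub>1\<close> is \<open>p k\<close>.\<close>

definition infinite_path :: "('v, 'e) pre_ultragraph \<Rightarrow> (nat \<Rightarrow> 'e) \<Rightarrow> bool" where
  "infinite_path G p \<longleftrightarrow>
     (\<forall>i. p i \<in> edges G) \<and> (\<forall>i. src G (p (Suc i)) \<in> rng G (p i))"

definition sink :: "('v, 'e) pre_ultragraph \<Rightarrow> 'v \<Rightarrow> bool" where
  "sink G v \<longleftrightarrow> {e \<in> edges G. src G e = v} = {}"

definition infinite_emitter :: "('v, 'e) pre_ultragraph \<Rightarrow> 'v \<Rightarrow> bool" where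
  "infinite_emitter G v \<longleftrightarrow> infinite {e \<in> edges G. src G e = v}"

definition row_finite :: "('v, 'e) pre_ultragraph \<Rightarrow> bool" where
  "row_finite G \<longleftrightarrow>
     (\<forall>e \<in> edges G. finite (rng G e)) \<and> (\<forall>v \<in> verts G. \<not> infinite_emitter G v)"

text \<open>
  Whether \<open>k\<close> ranges from 0 or from 1 is immaterial: if \<open>\<alpha>\<close> is a witness for \<open>k = 0\<close>, then
  \<open>\<alpha>e\<^sub>1\<close> is one for \<open>k = 1\<close>.
\<close>

definition condition_Y :: "('v, 'e) pre_ultragraph \<Rightarrow> bool" where
  "condition_Y G \<longleftrightarrow>
     (\<forall>p. infinite_path G p \<longrightarrow>
       (\<exists>k. \<exists>\<alpha> \<in> paths G. path_length \<alpha> = k + 1 \<and> src G (p k) \<in> path_rng G \<alpha>))"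


section \<open>Free algebras\<close>

text \<open>
  The monoid ring of the free monoid on \<open>'g\<close> over \<open>'r\<close>, i.e. the free unital associative algebra,
  is \<open>'g word \<Rightarrow>\<^sub>0 'r\<close> with the multiplication of \<^theory>\<open>HOL-Library.Poly_Mapping\<close>.
\<close>

datatype 'g word = Word (letters: "'g list")

instantiation word :: (type) monoid_add
begin

definition zero_word :: "'g word" where
  "zero_word = Word []"

definition plus_word :: "'g word \<Rightarrow> 'g word \<Rightarrow> 'g word" where
  "plus_word u v = Word (letters u @ letters v)"

instance
  by standard (simp_all add: zero_word_def plus_word_def)

end

definition gen :: "'g \<Rightarrow> ('g word \<Rightarrow>\<^sub>0 'r::comm_ring_1)" where
  "gen x = Poly_Mapping.single (Word [x]) 1"

definition scal :: "'r::comm_ring_1 \<Rightarrow> ('g word \<Rightarrow>\<^sub>0 'r)" where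
  "scal c = Poly_Mapping.single 0 c"

definition free_algebra :: "'g set \<Rightarrow> ('g word \<Rightarrow>\<^sub>0 'r::comm_ring_1) ring" where
  "free_algebra X =
     \<lparr>carrier = {f. \<forall>w \<in> Poly_Mapping.keys f. set (letters w) \<subseteq> X},
      monoid.mult = (*), one = 1, ring.zero = 0, add = (+)\<rparr>"


lemma ring_free_algebra: "ring (free_algebra X)"
proof -
  have keys_times: "set (letters w) \<subseteq> X"
    if "\<forall>w \<in> Poly_Mapping.keys f. set (letters w) \<subseteq> X"
      and "\<forall>w \<in> Poly_Mapping.keys g. set (letters w) \<subseteq> X"
      and "w \<in> Poly_Mapping.keys (f * g)"
    for f g :: "'a word \<Rightarrow>\<^sub>0 'b" and w
    using that keys_mult[of f g] by (fastforce simp: plus_word_def)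
  have keys_plus: "set (letters w) \<subseteq> X"
    if "\<forall>w \<in> Poly_Mapping.keys f. set (letters w) \<subseteq> X"
      and "\<forall>w \<in> Poly_Mapping.keys g. set (letters w) \<subseteq> X"
      and "w \<in> Poly_Mapping.keys (f + g)"
    for f g :: "'a word \<Rightarrow>\<^sub>0 'b" and w
    using that Poly_Mapping.keys_add[of f g] by blast
  show ?thesis
  proof (rule ringI)
    show "abelian_group (free_algebra X :: ('a word \<Rightarrow>\<^sub>0 'b) ring)"
    proof (rule abelian_groupI)
      fix f :: "'a word \<Rightarrow>\<^sub>0 'b"
      assume "f \<in> carrier (free_algebra X)"
      then show "\<exists>g \<in> carrier (free_algebra X).
          g \<oplus>\<^bsub>free_algebra X\<^esub> f = \<zero>\<^bsub>free_algebra X\<^esub>"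
        by (intro bexI[of _ "- f"]) (auto simp: free_algebra_def)
    qed (auto simp: free_algebra_def algebra_simps dest: keys_plus[rotated 2])
    show "Group.monoid (free_algebra X :: ('a word \<Rightarrow>\<^sub>0 'b) ring)"
      by (rule monoidI)
        (auto simp: free_algebra_def algebra_simps zero_word_def dest: keys_times[rotated 2])
  qed (auto simp: free_algebra_def algebra_simps)
qed


section \<open>Leavitt path algebras of ultragraphs\<close>

datatype ('v, 'e) lpa_gen = Edge 'e | Ghost 'e | Proj "'v set"

definition lpa_gens :: "('v, 'e) pre_ultragraph \<Rightarrow> ('v, 'e) lpa_gen set" where
  "lpa_gens G = Edge ` edges G \<union> Ghost ` edges G \<union> Proj ` gverts G"

type_synonym ('v, 'e, 'r) lpa_poly = "('v, 'e) lpa_gen word \<Rightarrow>\<^sub>0 'r"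

abbreviation gS :: "'e \<Rightarrow> ('v, 'e, 'r::comm_ring_1) lpa_poly" where
  "gS e \<equiv> gen (Edge e)"

abbreviation gS' :: "'e \<Rightarrow> ('v, 'e, 'r::comm_ring_1) lpa_poly" where
  "gS' e \<equiv> gen (Ghost e)"

abbreviation gP :: "'v set \<Rightarrow> ('v, 'e, 'r::comm_ring_1) lpa_poly" where
  "gP A \<equiv> gen (Proj A)"

text \<open>A relation \<open>x = y\<close> is represented by \<open>x - y\<close>.\<close>

definition lpa_relations ::
    "('v, 'e) pre_ultragraph \<Rightarrow> ('v, 'e, 'r::comm_ring_1) lpa_poly set" where
  "lpa_relations G =
     {gP {}}
   \<union> {gP A * gP B - gP (A \<inter> B) |A B. A \<in> gverts G \<and> B \<in> gverts G}
   \<union> {gP (A \<union> B) - (gP A + gP B - gP (A \<inter> B)) |A B. A \<in> gverts G \<and> B \<in> gverts G}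
   \<union> {gP {src G e} * gS e - gS e |e. e \<in> edges G}
   \<union> {gS e * gP (rng G e) - gS e |e. e \<in> edges G}
   \<union> {gP (rng G e) * gS' e - gS' e |e. e \<in> edges G}
   \<union> {gS' e * gP {src G e} - gS' e |e. e \<in> edges G}
   \<union> {gS' e * gS f - (if e = f then gP (rng G e) else 0) |e f. e \<in> edges G \<and> f \<in> edges G}
   \<union> {gP {v} - (\<Sum>e \<in> {e \<in> edges G. src G e = v}. gS e * gS' e) |v.
        v \<in> verts G \<and> \<not> sink G v \<and> \<not> infinite_emitter G v}"

lemma lpa_relations_subset:
  fixes G :: "('v, 'e) pre_ultragraph"
  assumes "ultragraph G"
  shows "(lpa_relations G :: ('v, 'e, 'r::comm_ring_1) lpa_poly set) \<subseteq> carrier (free_algebra (lpa_gens G))"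
proof -
  interpret ultragraph G by fact
  let ?C = "carrier (free_algebra (lpa_gens G)) :: ('v, 'e, 'r) lpa_poly set"
  interpret F: ring "free_algebra (lpa_gens G) :: ('v, 'e, 'r) lpa_poly ring"
    by (rule ring_free_algebra)
  have times: "x * y \<in> ?C" if "x \<in> ?C" "y \<in> ?C" for x y
    using F.m_closed[OF that] by (simp add: free_algebra_def)
  have plus: "x + y \<in> ?C" if "x \<in> ?C" "y \<in> ?C" for x y
    using F.add.m_closed[OF that] by (simp add: free_algebra_def)
  have uminus: "- x \<in> ?C" if "x \<in> ?C" for x
    using that by (simp add: free_algebra_def)
  have minus: "x - y \<in> ?C" if "x \<in> ?C" "y \<in> ?C" for x y
    using plus[OF that(1) uminus[OF that(2)]] by simp
  have zero: "0 \<in> ?C"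
    by (simp add: free_algebra_def)
  have sums: "sum f A \<in> ?C" if "\<And>i. i \<in> A \<Longrightarrow> f i \<in> ?C" for f :: "'e \<Rightarrow> _" and A
    using that by (induction A rule: infinite_finite_induct) (auto simp: zero plus)
  have gens: "gen x \<in> ?C" if "x \<in> lpa_gens G" for x
    using that by (simp add: free_algebra_def gen_def)
  have S: "gS e \<in> ?C" and S': "gS' e \<in> ?C" if "e \<in> edges G" for e
    using that by (intro gens; simp add: lpa_gens_def)+
  have P: "gP A \<in> ?C" if "A \<in> gverts G" for A
    using that by (intro gens; simp add: lpa_gens_def)+
  show ?thesis
    unfolding lpa_relations_def
    by (auto intro!: times plus minus sums S S' P zero gverts.intros src_in_verts)
qed

definition lpa_ideal ::
    "('v, 'e) pre_ultragraph \<Rightarrow> ('v, 'e, 'r::comm_ring_1) lpa_poly set" where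
  "lpa_ideal G = Idl\<^bsub>free_algebra (lpa_gens G)\<^esub> (lpa_relations G)"

definition lpa_class ::
    "('v, 'e) pre_ultragraph \<Rightarrow> ('v, 'e, 'r::comm_ring_1) lpa_poly \<Rightarrow>
      ('v, 'e, 'r) lpa_poly set" where
  "lpa_class G x = lpa_ideal G +>\<^bsub>free_algebra (lpa_gens G)\<^esub> x"

text \<open>
  The Leavitt path algebra is in general not unital: it is the universal algebra in the category of
  not necessarily unital algebras. The free such algebra consists of the elements of
  the free unital algebra without constant term. As the relations have no
  constant term, and the unital free algebra contains the scalars, the ideal they generate there is
  also the \<open>'r\<close>-algebra ideal they generate in the non-unital free algebra. Hence only
  the carrier of the quotient has to be cut down; the field \<open>one\<close> of the resulting record is
  not meaningful (it need not lie in the carrier).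
\<close>

definition lpa ::
    "('v, 'e) pre_ultragraph \<Rightarrow> ('v, 'e, 'r::comm_ring_1) lpa_poly set ring" where
  "lpa G = (free_algebra (lpa_gens G) Quot lpa_ideal G)
     \<lparr>carrier := {lpa_class G x |x.
        x \<in> carrier (free_algebra (lpa_gens G)) \<and> Poly_Mapping.lookup x 0 = 0}\<rparr>"

fun path_elem :: "('v, 'e) upath \<Rightarrow> ('v, 'e, 'r::comm_ring_1) lpa_poly" where
  "path_elem (GVert A) = gP A"
| "path_elem (EPath es) = prod_list (map gS es)"

fun path_elem' :: "('v, 'e) upath \<Rightarrow> ('v, 'e, 'r::comm_ring_1) lpa_poly" where
  "path_elem' (GVert A) = gP A"
| "path_elem' (EPath es) = prod_list (map gS' (rev es))"

definition lpa_component ::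
    "('v, 'e) pre_ultragraph \<Rightarrow> int \<Rightarrow> ('v, 'e, 'r::comm_ring_1) lpa_poly set set" where
  "lpa_component G m =
     {lpa_class G (\<Sum>(c, \<alpha>, A, \<beta>) \<leftarrow> ts. scal c * path_elem \<alpha> * gP A * path_elem' \<beta>) |ts.
        \<forall>(c, \<alpha>, A, \<beta>) \<in> set ts. \<alpha> \<in> paths G \<and> \<beta> \<in> paths G \<and> A \<in> gverts G \<and>
          int (path_length \<alpha>) - int (path_length \<beta>) = m}"


section \<open>Graded rings\<close>

text \<open>
  These notions do not refer to \<open>one\<close>, so they apply to rings without unit.
\<close>

definition set_prod :: "('a, 'b) ring_scheme \<Rightarrow> 'a set \<Rightarrow> 'a set \<Rightarrow> 'a set" where
  "set_prod T A B =
     {\<Oplus>\<^bsub>T\<^esub>i \<in> {..<n}. a i \<otimes>\<^bsub>T\<^esub> b i |(n::nat) a b. (\<forall>i<n. a i \<in> A) \<and> (\<forall>i<n. b i \<in> B)}"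

definition graded :: "('a, 'b) ring_scheme \<Rightarrow> (int \<Rightarrow> 'a set) \<Rightarrow> bool" where
  "graded T D \<longleftrightarrow>
     (\<forall>n. additive_subgroup (D n) T) \<and>
     (\<forall>m n. set_prod T (D m) (D n) \<subseteq> D (m + n)) \<and>
     (\<forall>x \<in> carrier T. \<exists>!d. (\<forall>n. d n \<in> D n) \<and> finite {n. d n \<noteq> \<zero>\<^bsub>T\<^esub>} \<and>
        x = (\<Oplus>\<^bsub>T\<^esub>n \<in> {n. d n \<noteq> \<zero>\<^bsub>T\<^esub>}. d n))"

definition strongly_graded :: "('a, 'b) ring_scheme \<Rightarrow> (int \<Rightarrow> 'a set) \<Rightarrow> bool" where
  "strongly_graded T D \<longleftrightarrow>
     graded T D \<and> (\<forall>m n. set_prod T (D m) (D n) = D (m + n))"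

end

theory Submission
  imports Defs
begin

text \<open>The homogeneous component of degree \<open>n\<close> is the image of the polynomials all of whose words are
  nonempty of degree \<open>n\<close>, and the defining ideal is homogeneous; so the algebra is always graded.
  If there are no sinks and the ultragraph is row-finite, every projection is a finite sum of
  \<open>p\<^sub>v = \<Sum> s\<^sub>e s\<^sub>e\<^sup>* \<in> L\<^sub>1 L\<^sub>-\<^sub>1\<close>. If some \<open>p\<^sub>v\<close> were not in \<open>L\<^sub>-\<^sub>1 L\<^sub>1\<close>, then splitting
  it again and again yields, as in Koenig's lemma, an infinite path such that no
  \<open>s\<^sub>\<alpha> p\<^sub>w s\<^sub>\<alpha>\<^sup>*\<close> along it is in \<open>L\<^sub>-\<^sub>1 L\<^sub>1\<close>. This contradicts Condition (Y): a path \<open>\<beta>\<close>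
  with \<open>|\<beta>| = |\<alpha>| + 1\<close> and \<open>w \<in> r(\<beta>)\<close> gives
  \<open>s\<^sub>\<alpha> p\<^sub>w s\<^sub>\<alpha>\<^sup>* = (s\<^sub>\<alpha> p\<^sub>w s\<^sub>\<beta>\<^sup>*) (s\<^sub>\<beta> p\<^sub>w s\<^sub>\<alpha>\<^sup>*)\<close>. As the projections are local units,
  the two memberships suffice.

  Conversely, the algebra acts on functions on boundary paths. The component \<open>L\<^sub>-\<^sub>1\<close> kills the
  indicator of a sink or infinite emitter \<open>v\<close>, and \<open>p\<^sub>v\<close> does not, so \<open>p\<^sub>v\<close> is not in \<open>L\<^sub>1 L\<^sub>-\<^sub>1\<close>.
  For an element of \<open>L\<^sub>1 L\<^sub>-\<^sub>1\<close>, all functions in its image are supported on the paths that start with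
  one of finitely many edges, and this fails for \<open>p\<^sub>A\<close> if \<open>A\<close> is infinite. Finally, \<open>L\<^sub>1\<close> kills the
  indicator of an infinite path that violates Condition (Y), and \<open>p\<^sub>v\<close> does not if \<open>v\<close> is the
  source of that path, so \<open>p\<^sub>v\<close> is not in \<open>L\<^sub>-\<^sub>1 L\<^sub>1\<close>.\<close>

section \<open>The free algebra and the defining ideal\<close>

text \<open>Multiplicative identities are reduced to single words through this expansion. Several
  are first proved for sums with an arbitrary index set and arbitrary coefficients, because
  rewriting \<open>f\<close> directly would also hit the copies of \<open>f\<close> inside its own
  expansion.\<close>

lemma poly_mapping_eq_sum_single:
  fixes f :: "'a \<Rightarrow>\<^sub>0 'b::comm_monoid_add"
  shows "f = (\<Sum>w\<in>Poly_Mapping.keys f. Poly_Mapping.single w (Poly_Mapping.lookup f w))"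
  by (rule poly_mapping_eqI)
    (auto simp: lookup_sum lookup_single when_def sum.delta in_keys_iff)

lemma letters_plus [simp]: "letters (u + v) = letters u @ letters v"
  by (simp add: plus_word_def)

lemma letters_zero [simp]: "letters 0 = []"
  by (simp add: zero_word_def)

lemma letters_eq_Nil_iff [simp]: "letters w = [] \<longleftrightarrow> w = 0"
  by (cases w) (simp add: zero_word_def)

lemma gen_mult_single: "gen x * Poly_Mapping.single w c = Poly_Mapping.single (Word [x] + w) c"
  by (simp add: gen_def mult_single)

lemma in_free_algebra_iff:
  "f \<in> carrier (free_algebra X) \<longleftrightarrow> (\<forall>w\<in>Poly_Mapping.keys f. set (letters w) \<subseteq> X)"
  by (simp add: free_algebra_def)

lemma free_algebra_ops:
  "x \<otimes>\<^bsub>free_algebra X\<^esub> y = x * y"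
  "x \<oplus>\<^bsub>free_algebra X\<^esub> y = x + y"
  "\<zero>\<^bsub>free_algebra X\<^esub> = 0"
  "\<one>\<^bsub>free_algebra X\<^esub> = 1"
  by (simp_all add: free_algebra_def)

lemma free_algebra_closed [simp, intro]:
  fixes f g :: "'a word \<Rightarrow>\<^sub>0 'r::comm_ring_1"
  shows "(0 :: 'a word \<Rightarrow>\<^sub>0 'r) \<in> carrier (free_algebra X)"
    and "(1 :: 'a word \<Rightarrow>\<^sub>0 'r) \<in> carrier (free_algebra X)"
    and "scal c \<in> carrier (free_algebra X)"
    and "x \<in> X \<Longrightarrow> (gen x :: 'a word \<Rightarrow>\<^sub>0 'r) \<in> carrier (free_algebra X)"
    and "set (letters w) \<subseteq> X \<Longrightarrow> Poly_Mapping.single w c \<in> carrier (free_algebra X)"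
    and "f \<in> carrier (free_algebra X) \<Longrightarrow> g \<in> carrier (free_algebra X) \<Longrightarrow>
      f + g \<in> carrier (free_algebra X)"
    and "f \<in> carrier (free_algebra X) \<Longrightarrow> g \<in> carrier (free_algebra X) \<Longrightarrow>
      f * g \<in> carrier (free_algebra X)"
    and "f \<in> carrier (free_algebra X) \<Longrightarrow> - f \<in> carrier (free_algebra X)"
    and "f \<in> carrier (free_algebra X) \<Longrightarrow> g \<in> carrier (free_algebra X) \<Longrightarrow>
      f - g \<in> carrier (free_algebra X)"
proof -
  interpret ring "free_algebra X :: ('a word \<Rightarrow>\<^sub>0 'r) ring"
    by (rule ring_free_algebra)
  show plus: "f + g \<in> carrier (free_algebra X)"
    if "f \<in> carrier (free_algebra X)" "g \<in> carrier (free_algebra X)"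
    for f g :: "'a word \<Rightarrow>\<^sub>0 'r"
    using add.m_closed[OF that] by (simp add: free_algebra_ops)
  show "f * g \<in> carrier (free_algebra X)"
    if "f \<in> carrier (free_algebra X)" "g \<in> carrier (free_algebra X)"
    using m_closed[OF that] by (simp add: free_algebra_ops)
  show uminus: "- f \<in> carrier (free_algebra X)" if "f \<in> carrier (free_algebra X)"
    for f :: "'a word \<Rightarrow>\<^sub>0 'r"
    using that by (simp add: in_free_algebra_iff)
  show "f - g \<in> carrier (free_algebra X)"
    if "f \<in> carrier (free_algebra X)" "g \<in> carrier (free_algebra X)"
    using plus[OF that(1) uminus[OF that(2)]] by simp
qed (simp_all add: in_free_algebra_iff gen_def scal_def)

lemma free_algebra_sum_closed [simp, intro]:
  "(\<And>i. i \<in> A \<Longrightarrow> f i \<in> carrier (free_algebra X)) \<Longrightarrow> sum f A \<in> carrier (free_algebra X)"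
  by (induction A rule: infinite_finite_induct) auto

lemma scal_commute: "scal c * f = f * scal c"
proof -
  have "scal c * (\<Sum>w\<in>A. Poly_Mapping.single w (h w)) = (\<Sum>w\<in>A. Poly_Mapping.single w (h w)) * scal c"
    for A :: "'a word set" and h
    by (simp add: sum_distrib_left sum_distrib_right scal_def mult_single mult.commute)
  from this[where A = "Poly_Mapping.keys f" and h = "Poly_Mapping.lookup f"] show ?thesis
    by (simp only: poly_mapping_eq_sum_single[symmetric])
qed

lemma scal_one [simp]: "scal 1 = 1"
  by (simp add: scal_def)

section \<open>Degrees of words and homogeneous parts\<close>

fun gen_deg :: "('v, 'e) lpa_gen \<Rightarrow> int" where
  "gen_deg (Edge e) = 1"
| "gen_deg (Ghost e) = - 1"
| "gen_deg (Proj A) = 0"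

definition word_deg :: "('v, 'e) lpa_gen word \<Rightarrow> int" where
  "word_deg w = (\<Sum>x\<leftarrow>letters w. gen_deg x)"

lemma word_deg_simps [simp]:
  "word_deg 0 = 0" "word_deg (u + v) = word_deg u + word_deg v" "word_deg (Word [x]) = gen_deg x"
  by (simp_all add: word_deg_def)

text \<open>The projection onto degree \<open>n\<close> in the grading of the free algebra by word
  degree.\<close>

definition hpart :: "int \<Rightarrow> ('v, 'e, 'r::comm_ring_1) lpa_poly \<Rightarrow> ('v, 'e, 'r) lpa_poly" where
  "hpart n f =
     (\<Sum>w\<in>{w \<in> Poly_Mapping.keys f. word_deg w = n}. Poly_Mapping.single w (Poly_Mapping.lookup f w))"

lemma lookup_hpart:
  "Poly_Mapping.lookup (hpart n f) w = (if word_deg w = n then Poly_Mapping.lookup f w else 0)"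
proof -
  have "Poly_Mapping.lookup (hpart n f) w =
      (\<Sum>v\<in>{w \<in> Poly_Mapping.keys f. word_deg w = n}. if w = v then Poly_Mapping.lookup f v else 0)"
    by (auto simp: hpart_def lookup_sum lookup_single when_def intro!: sum.cong)
  also have "\<dots> = (if word_deg w = n then Poly_Mapping.lookup f w else 0)"
    by (subst sum.delta') (auto simp: in_keys_iff)
  finally show ?thesis .
qed

lemma hpart_add: "hpart n (f + g) = hpart n f + hpart n g"
  by (rule poly_mapping_eqI) (simp add: lookup_hpart lookup_add)

lemma hpart_diff: "hpart n (f - g) = hpart n f - hpart n g"
  by (rule poly_mapping_eqI) (simp add: lookup_hpart lookup_minus)

lemma hpart_zero [simp]: "hpart n 0 = 0"
  by (rule poly_mapping_eqI) (simp add: lookup_hpart)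

lemma hpart_sum: "hpart n (sum f A) = (\<Sum>i\<in>A. hpart n (f i))"
  by (induction A rule: infinite_finite_induct) (simp_all add: hpart_add)

lemma hpart_single:
  "hpart n (Poly_Mapping.single w c) = (if word_deg w = n then Poly_Mapping.single w c else 0)"
  by (rule poly_mapping_eqI) (auto simp: lookup_hpart lookup_single when_def)

lemma hpart_single_mult:
  "hpart n (Poly_Mapping.single u c * f) = Poly_Mapping.single u c * hpart (n - word_deg u) f"
proof -
  have "hpart n (Poly_Mapping.single u c * (\<Sum>w\<in>A. Poly_Mapping.single w (h w))) =
      Poly_Mapping.single u c * hpart (n - word_deg u) (\<Sum>w\<in>A. Poly_Mapping.single w (h w))"
    for A and h :: "('a, 'b) lpa_gen word \<Rightarrow> 'c"
    unfolding hpart_sum sum_distrib_left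
    by (rule sum.cong) (auto simp: hpart_single mult_single)
  from this[where A = "Poly_Mapping.keys f" and h = "Poly_Mapping.lookup f"] show ?thesis
    by (simp only: poly_mapping_eq_sum_single[symmetric])
qed

lemma hpart_mult_single:
  "hpart n (f * Poly_Mapping.single u c) = hpart (n - word_deg u) f * Poly_Mapping.single u c"
proof -
  have "hpart n ((\<Sum>w\<in>A. Poly_Mapping.single w (h w)) * Poly_Mapping.single u c) =
      hpart (n - word_deg u) (\<Sum>w\<in>A. Poly_Mapping.single w (h w)) * Poly_Mapping.single u c"
    for A and h :: "('a, 'b) lpa_gen word \<Rightarrow> 'c"
    unfolding hpart_sum sum_distrib_right
    by (rule sum.cong) (auto simp: hpart_single mult_single)
  from this[where A = "Poly_Mapping.keys f" and h = "Poly_Mapping.lookup f"] show ?thesis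
    by (simp only: poly_mapping_eq_sum_single[symmetric])
qed

text \<open>The words have to be nonempty since the Leavitt path algebra need not be unital.\<close>

definition hcomp :: "('v, 'e) pre_ultragraph \<Rightarrow> int \<Rightarrow> ('v, 'e, 'r::comm_ring_1) lpa_poly set" where
  "hcomp G n = {f. \<forall>w\<in>Poly_Mapping.keys f. set (letters w) \<subseteq> lpa_gens G \<and> w \<noteq> 0 \<and> word_deg w = n}"

lemma hcomp_zero [simp, intro]: "0 \<in> hcomp G n"
  by (simp add: hcomp_def)

lemma hcomp_uminus [intro]: "f \<in> hcomp G n \<Longrightarrow> - f \<in> hcomp G n"
  by (simp add: hcomp_def)

lemma hcomp_add [intro]: "f \<in> hcomp G n \<Longrightarrow> g \<in> hcomp G n \<Longrightarrow> f + g \<in> hcomp G n"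
  using Poly_Mapping.keys_add[of f g] by (auto simp: hcomp_def)

lemma hcomp_sum [intro]: "(\<And>i. i \<in> A \<Longrightarrow> f i \<in> hcomp G n) \<Longrightarrow> sum f A \<in> hcomp G n"
  by (induction A rule: infinite_finite_induct) auto

lemma hcomp_mult [intro]: "f \<in> hcomp G m \<Longrightarrow> g \<in> hcomp G n \<Longrightarrow> f * g \<in> hcomp G (m + n)"
proof -
  assume f: "f \<in> hcomp G m" and g: "g \<in> hcomp G n"
  have "set (letters w) \<subseteq> lpa_gens G \<and> w \<noteq> 0 \<and> word_deg w = m + n"
    if "w \<in> Poly_Mapping.keys (f * g)" for w
  proof -
    from that keys_mult[of f g] obtain u v
      where w: "w = u + v" and u: "u \<in> Poly_Mapping.keys f" and v: "v \<in> Poly_Mapping.keys g"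
      by blast
    from f u have "set (letters u) \<subseteq> lpa_gens G" "u \<noteq> 0" "word_deg u = m"
      by (simp_all add: hcomp_def)
    moreover from g v have "set (letters v) \<subseteq> lpa_gens G" "word_deg v = n"
      by (simp_all add: hcomp_def)
    moreover from \<open>u \<noteq> 0\<close> have "u + v \<noteq> 0"
      by (simp flip: letters_eq_Nil_iff)
    ultimately show ?thesis
      by (simp add: w)
  qed
  then show ?thesis
    by (simp add: hcomp_def)
qed

lemma hcomp_single [intro]:
  "set (letters w) \<subseteq> lpa_gens G \<Longrightarrow> w \<noteq> 0 \<Longrightarrow> word_deg w = n \<Longrightarrow> Poly_Mapping.single w c \<in> hcomp G n"
  by (simp add: hcomp_def)

lemma hcomp_gen [intro]: "x \<in> lpa_gens G \<Longrightarrow> gen_deg x = n \<Longrightarrow> gen x \<in> hcomp G n"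
  by (auto simp: gen_def simp flip: letters_eq_Nil_iff)

lemma hcomp_scal_mult [intro]: "f \<in> hcomp G n \<Longrightarrow> scal c * f \<in> hcomp G n"
proof -
  assume f: "f \<in> hcomp G n"
  have "Poly_Mapping.keys (scal c * f) \<subseteq> Poly_Mapping.keys f"
    using keys_mult[of "scal c" f] by (auto simp: scal_def split: if_splits)
  with f show ?thesis
    by (auto simp: hcomp_def)
qed

lemma hcomp_subset: "hcomp G n \<subseteq> carrier (free_algebra (lpa_gens G))"
  by (auto simp: hcomp_def in_free_algebra_iff)

lemma hcomp_lookup_zero: "f \<in> hcomp G n \<Longrightarrow> Poly_Mapping.lookup f 0 = 0"
  by (auto simp: hcomp_def in_keys_iff)

lemma hpart_in_hcomp:
  "f \<in> carrier (free_algebra (lpa_gens G)) \<Longrightarrow> Poly_Mapping.lookup f 0 = 0 \<Longrightarrow> hpart n f \<in> hcomp G n"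
  by (auto simp: hcomp_def in_free_algebra_iff in_keys_iff lookup_hpart split: if_splits)

lemma hpart_hcomp: "f \<in> hcomp G m \<Longrightarrow> hpart n f = (if n = m then f else 0)"
  by (rule poly_mapping_eqI) (auto simp: hcomp_def lookup_hpart in_keys_iff)

lemma lpa_gens_iff [simp]:
  "Edge e \<in> lpa_gens G \<longleftrightarrow> e \<in> edges G"
  "Ghost e \<in> lpa_gens G \<longleftrightarrow> e \<in> edges G"
  "Proj A \<in> lpa_gens G \<longleftrightarrow> A \<in> gverts G"
  by (auto simp: lpa_gens_def)

text \<open>The parameter of type \<open>'r itself\<close> keeps the ring of scalars fixed.\<close>

locale leavitt = ultragraph G for G :: "('v, 'e) pre_ultragraph" +
  fixes R :: "'r::comm_ring_1 itself"
begin

abbreviation F :: "('v, 'e, 'r) lpa_poly set" where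
  "F \<equiv> carrier (free_algebra (lpa_gens G))"

abbreviation I :: "('v, 'e, 'r) lpa_poly set" where
  "I \<equiv> lpa_ideal G"

lemma ideal_lpa_ideal:
  "ideal (I :: ('v, 'e, 'r) lpa_poly set) (free_algebra (lpa_gens G))"
  unfolding lpa_ideal_def
  by (rule ring.genideal_ideal[OF ring_free_algebra])
    (rule lpa_relations_subset[OF ultragraph_axioms])

lemma relation_in_ideal: "f \<in> lpa_relations G \<Longrightarrow> f \<in> I"
  unfolding lpa_ideal_def
  using ring.genideal_self[OF ring_free_algebra lpa_relations_subset[OF ultragraph_axioms]] by blast

lemma lpa_ideal_closed:
  fixes f :: "('v, 'e, 'r) lpa_poly"
  shows ideal_in_F: "f \<in> I \<Longrightarrow> f \<in> F"
    and ideal_zero: "(0 :: ('v, 'e, 'r) lpa_poly) \<in> I"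
    and ideal_add: "f \<in> I \<Longrightarrow> g \<in> I \<Longrightarrow> f + g \<in> I"
    and ideal_mult_left: "a \<in> F \<Longrightarrow> f \<in> I \<Longrightarrow> a * f \<in> I"
    and ideal_mult_right: "a \<in> F \<Longrightarrow> f \<in> I \<Longrightarrow> f * a \<in> I"
proof -
  interpret ideal "I :: ('v, 'e, 'r) lpa_poly set" "free_algebra (lpa_gens G)"
    by (rule ideal_lpa_ideal)
  show "f \<in> I \<Longrightarrow> f \<in> F" by (rule a_Hcarr)
  show "(0 :: ('v, 'e, 'r) lpa_poly) \<in> I" using additive_subgroup.zero_closed[OF is_additive_subgroup] by (simp add: free_algebra_ops)
  show "f \<in> I \<Longrightarrow> g \<in> I \<Longrightarrow> f + g \<in> I" using additive_subgroup.a_closed[OF is_additive_subgroup, of f g] by (simp add: free_algebra_ops)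
  show "a \<in> F \<Longrightarrow> f \<in> I \<Longrightarrow> a * f \<in> I" using I_l_closed[of f a] by (simp add: free_algebra_ops)
  show "a \<in> F \<Longrightarrow> f \<in> I \<Longrightarrow> f * a \<in> I" using I_r_closed[of f a] by (simp add: free_algebra_ops)
qed

lemma ideal_uminus: "f \<in> I \<Longrightarrow> - f \<in> I"
  using ideal_mult_left[of "- 1" f] by auto

lemma ideal_diff: "f \<in> I \<Longrightarrow> g \<in> I \<Longrightarrow> f - g \<in> I"
  using ideal_add[of f "- g"] ideal_uminus[of g] by simp

text \<open>The elements of \<open>F\<close> with property \<open>P\<close> form an ideal that
  contains the relations, hence also the ideal generated by them. Negatives are products with
  -1.\<close>

lemma lpa_ideal_induct [consumes 1, case_names relation zero add mult_left mult_right]: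
  fixes f :: "('v, 'e, 'r) lpa_poly"
  assumes "f \<in> I"
    and relation: "\<And>f. f \<in> lpa_relations G \<Longrightarrow> P f"
    and zero: "P 0"
    and add: "\<And>f g. f \<in> F \<Longrightarrow> g \<in> F \<Longrightarrow> P f \<Longrightarrow> P g \<Longrightarrow> P (f + g)"
    and mult_left: "\<And>a f. a \<in> F \<Longrightarrow> f \<in> F \<Longrightarrow> P f \<Longrightarrow> P (a * f)"
    and mult_right: "\<And>a f. a \<in> F \<Longrightarrow> f \<in> F \<Longrightarrow> P f \<Longrightarrow> P (f * a)"
  shows "P f"
proof -
  let ?R = "free_algebra (lpa_gens G) :: ('v, 'e, 'r) lpa_poly ring"
  interpret R: ring ?R by (rule ring_free_algebra)
  let ?J = "{f \<in> F. P f}"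
  have inv: "\<ominus>\<^bsub>?R\<^esub> f = - f" if "f \<in> F" for f
    using that by (intro R.minus_equality) (auto simp: free_algebra_ops)
  have "P (- f)" if "f \<in> F" "P f" for f
    using mult_left[of "- 1" f] that by auto
  then have "subgroup ?J (add_monoid ?R)"
    using inv by unfold_locales (auto simp: zero add free_algebra_ops a_inv_def)
  then have "ideal ?J ?R"
    by (rule idealI[OF ring_free_algebra]) (auto simp: mult_left mult_right free_algebra_ops)
  moreover have "lpa_relations G \<subseteq> ?J"
    using lpa_relations_subset[OF ultragraph_axioms] relation by auto
  ultimately have "I \<subseteq> ?J"
    unfolding lpa_ideal_def by (rule R.genideal_minimal)
  with assms(1) show ?thesis by blast
qed

end

section \<open>Computing modulo the defining ideal\<close>

context leavitt
begin

text \<open>Congruence modulo the defining ideal. Both sides have to lie in \<open>F\<close>,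
  because the ideal absorbs factors from \<open>F\<close>; in this way products of congruent
  elements stay congruent.\<close>

definition eqv :: "('v, 'e, 'r) lpa_poly \<Rightarrow> ('v, 'e, 'r) lpa_poly \<Rightarrow> bool" (infix "\<sim>" 50)
  where "f \<sim> g \<longleftrightarrow> f \<in> F \<and> g \<in> F \<and> f - g \<in> I"

lemma eqvI: "g \<in> F \<Longrightarrow> f - g \<in> I \<Longrightarrow> f \<sim> g"
  unfolding eqv_def using free_algebra_closed(6)[OF ideal_in_F, of "f - g" g] by auto

lemma eqv_in_F: assumes "f \<sim> g" shows "f \<in> F" "g \<in> F"
  using assms by (auto simp: eqv_def)

lemma eqv_refl [simp, intro]: "f \<in> F \<Longrightarrow> f \<sim> f"
  by (simp add: eqv_def ideal_zero)

lemma eqv_sym: "f \<sim> g \<Longrightarrow> g \<sim> f"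
  unfolding eqv_def using ideal_uminus[of "f - g"] by simp

lemma eqv_trans [trans]: "f \<sim> g \<Longrightarrow> g \<sim> h \<Longrightarrow> f \<sim> h"
  unfolding eqv_def using ideal_add[of "f - g" "g - h"] by simp

lemma eqv_add: "f \<sim> f' \<Longrightarrow> g \<sim> g' \<Longrightarrow> f + g \<sim> f' + g'"
  unfolding eqv_def using ideal_add[of "f - f'" "g - g'"] by (auto simp: algebra_simps)

lemma eqv_diff: "f \<sim> f' \<Longrightarrow> g \<sim> g' \<Longrightarrow> f - g \<sim> f' - g'"
  unfolding eqv_def using ideal_diff[of "f - f'" "g - g'"] by (auto simp: algebra_simps)

lemma eqv_mult:
  assumes "f \<sim> f'" "g \<sim> g'"
  shows "f * g \<sim> f' * g'"
proof -
  have "f * g - f' * g' = (f - f') * g + f' * (g - g')"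
    by (simp add: algebra_simps)
  with assms show ?thesis
    unfolding eqv_def
    by (simp add: ideal_add[OF ideal_mult_right ideal_mult_left])
qed

lemma eqv_sum: "(\<And>i. i \<in> A \<Longrightarrow> f i \<sim> g i) \<Longrightarrow> sum f A \<sim> sum g A"
  by (induction A rule: infinite_finite_induct) (auto intro: eqv_add)

lemma eqv_multL: "f \<sim> f' \<Longrightarrow> g \<in> F \<Longrightarrow> f * g \<sim> f' * g"
  by (rule eqv_mult) auto

lemma eqv_multR: "g \<sim> g' \<Longrightarrow> f \<in> F \<Longrightarrow> f * g \<sim> f * g'"
  by (rule eqv_mult) auto

lemma ideal_iff_eqv_zero: "f \<in> I \<longleftrightarrow> f \<sim> 0"
  by (auto simp: eqv_def ideal_in_F)

lemma lpa_class_eq_iff: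
  fixes f g :: "('v, 'e, 'r) lpa_poly"
  assumes "f \<in> F" "g \<in> F"
  shows "lpa_class G f = lpa_class G g \<longleftrightarrow> f \<sim> g"
proof -
  let ?R = "free_algebra (lpa_gens G) :: ('v, 'e, 'r) lpa_poly ring"
  interpret R: ring ?R by (rule ring_free_algebra)
  have "\<ominus>\<^bsub>?R\<^esub> g = - g"
    using assms by (intro R.minus_equality) (auto simp: free_algebra_ops)
  then have "f \<ominus>\<^bsub>?R\<^esub> g = f - g"
    by (simp add: a_minus_def free_algebra_ops)
  with R.quotient_eq_iff_same_a_r_cos[OF ideal_lpa_ideal assms] assms show ?thesis
    by (simp add: lpa_class_def eqv_def)
qed

lemma finite_subset_in_gverts: "finite A \<Longrightarrow> A \<subseteq> verts G \<Longrightarrow> A \<in> gverts G"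
  by (induction A rule: finite_induct) (use gverts.union[OF gverts.vertex] in \<open>auto intro: gverts.empty\<close>)

lemma gverts_src [simp, intro]: "e \<in> edges G \<Longrightarrow> {src G e} \<in> gverts G"
  by (simp add: gverts.vertex src_in_verts)

lemmas gverts_intros [simp, intro] = gverts.empty gverts.rng gverts.union gverts.inter

lemma gens_in_F [simp, intro]:
  "e \<in> edges G \<Longrightarrow> gS e \<in> F" "e \<in> edges G \<Longrightarrow> gS' e \<in> F" "A \<in> gverts G \<Longrightarrow> gP A \<in> F"
  by simp_all

lemma eqv_P_empty: "gP {} \<sim> 0"
  unfolding ideal_iff_eqv_zero[symmetric]
  by (rule relation_in_ideal) (simp add: lpa_relations_def)

lemma eqv_P_P: "A \<in> gverts G \<Longrightarrow> B \<in> gverts G \<Longrightarrow> gP A * gP B \<sim> gP (A \<inter> B)"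
  by (intro eqvI relation_in_ideal) (simp, unfold lpa_relations_def, blast)

lemma eqv_P_union:
  "A \<in> gverts G \<Longrightarrow> B \<in> gverts G \<Longrightarrow> gP (A \<union> B) \<sim> gP A + gP B - gP (A \<inter> B)"
  by (intro eqvI relation_in_ideal) (simp, unfold lpa_relations_def, blast)

lemma eqv_src_S: "e \<in> edges G \<Longrightarrow> gP {src G e} * gS e \<sim> gS e"
  by (intro eqvI relation_in_ideal) (simp, unfold lpa_relations_def, blast)

lemma eqv_S_rng: "e \<in> edges G \<Longrightarrow> gS e * gP (rng G e) \<sim> gS e"
  by (intro eqvI relation_in_ideal) (simp, unfold lpa_relations_def, blast)

lemma eqv_rng_S': "e \<in> edges G \<Longrightarrow> gP (rng G e) * gS' e \<sim> gS' e"
  by (intro eqvI relation_in_ideal) (simp, unfold lpa_relations_def, blast)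

lemma eqv_S'_src: "e \<in> edges G \<Longrightarrow> gS' e * gP {src G e} \<sim> gS' e"
  by (intro eqvI relation_in_ideal) (simp, unfold lpa_relations_def, blast)

lemma eqv_S'_S:
  assumes "e \<in> edges G" "f \<in> edges G"
  shows "gS' e * gS f \<sim> (if e = f then gP (rng G e) else 0)"
proof (intro eqvI relation_in_ideal)
  show "gS' e * gS f - (if e = f then gP (rng G e) else 0) \<in> lpa_relations G"
    unfolding lpa_relations_def using assms by blast
qed (use assms in simp)

lemma eqv_CK:
  assumes "v \<in> verts G" "\<not> sink G v" "\<not> infinite_emitter G v"
  shows "gP {v} \<sim> (\<Sum>e \<in> {e \<in> edges G. src G e = v}. gS e * gS' e)"
proof (intro eqvI relation_in_ideal)
  show "gP {v} - (\<Sum>e \<in> {e \<in> edges G. src G e = v}. gS e * gS' e) \<in> lpa_relations G"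
    unfolding lpa_relations_def using assms by blast
qed (use assms in \<open>auto intro!: free_algebra_sum_closed\<close>)

text \<open>The projection \<open>gP {src G e}\<close> is inserted in front of \<open>gS e\<close>
  and merged with \<open>gP A\<close>; the intersection is \<open>{src G e}\<close> or
  empty.\<close>

lemma eqv_P_S:
  assumes "A \<in> gverts G" "e \<in> edges G"
  shows "gP A * gS e \<sim> (if src G e \<in> A then gS e else 0)"
proof -
  have "gP A * gS e \<sim> gP A * (gP {src G e} * gS e)"
    using assms by (intro eqv_multR eqv_sym[OF eqv_src_S]) auto
  also have "\<dots> = gP A * gP {src G e} * gS e"
    by (simp add: mult.assoc)
  also have "\<dots> \<sim> gP (A \<inter> {src G e}) * gS e"
    using assms by (intro eqv_multL eqv_P_P) auto
  also have "\<dots> \<sim> (if src G e \<in> A then gS e else 0)"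
    using eqv_src_S[OF assms(2)] eqv_multL[OF eqv_P_empty, of "gS e"] assms by simp
  finally show ?thesis .
qed

lemma eqv_S'_P:
  assumes "A \<in> gverts G" "e \<in> edges G"
  shows "gS' e * gP A \<sim> (if src G e \<in> A then gS' e else 0)"
proof -
  have "gS' e * gP A \<sim> gS' e * gP {src G e} * gP A"
    using assms by (intro eqv_multL eqv_sym[OF eqv_S'_src]) auto
  also have "\<dots> = gS' e * (gP {src G e} * gP A)"
    by (simp add: mult.assoc)
  also have "\<dots> \<sim> gS' e * gP ({src G e} \<inter> A)"
    using assms by (intro eqv_multR eqv_P_P) auto
  also have "\<dots> \<sim> (if src G e \<in> A then gS' e else 0)"
    using eqv_S'_src[OF assms(2)] eqv_multR[OF eqv_P_empty, of "gS' e"] assms by simp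
  finally show ?thesis .
qed

text \<open>For edges that do not compose, \<open>gP (rng G e)\<close> can be inserted between them
  and kills \<open>gS f\<close>.\<close>

lemma eqv_S_S_zero:
  assumes "e \<in> edges G" "f \<in> edges G" "src G f \<notin> rng G e"
  shows "gS e * gS f \<sim> 0"
proof -
  have "gS e * gS f \<sim> gS e * gP (rng G e) * gS f"
    using assms by (intro eqv_multL eqv_sym[OF eqv_S_rng]) auto
  also have "\<dots> = gS e * (gP (rng G e) * gS f)"
    by (simp add: mult.assoc)
  also have "\<dots> \<sim> gS e * 0"
    using assms eqv_P_S[of "rng G e" f] by (intro eqv_multR) auto
  finally show ?thesis by simp
qed

lemma eqv_S'_S'_zero:
  assumes "e \<in> edges G" "f \<in> edges G" "src G e \<notin> rng G f"
  shows "gS' e * gS' f \<sim> 0"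
proof -
  have "gS' e * gS' f \<sim> gS' e * (gP (rng G f) * gS' f)"
    using assms by (intro eqv_multR eqv_sym[OF eqv_rng_S']) auto
  also have "\<dots> = gS' e * gP (rng G f) * gS' f"
    by (simp add: mult.assoc)
  also have "\<dots> \<sim> 0 * gS' f"
    using assms eqv_S'_P[of "rng G f" e] by (intro eqv_multL) auto
  finally show ?thesis by simp
qed


section \<open>Spanning by monomials\<close>

text \<open>Edge paths with the empty list allowed, so that paths of length 0 need no separate case
  in monomials: their generalized vertex is absorbed by the middle projection of
  \<open>mon\<close>.\<close>

definition chain :: "'e list \<Rightarrow> bool" where
  "chain es \<longleftrightarrow> set es \<subseteq> edges G \<and> successively (\<lambda>e f. src G f \<in> rng G e) es"

definition sS :: "'e list \<Rightarrow> ('v, 'e, 'r) lpa_poly" where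
  "sS es = prod_list (map gS es)"

definition sS' :: "'e list \<Rightarrow> ('v, 'e, 'r) lpa_poly" where
  "sS' es = prod_list (map gS' (rev es))"

definition mon :: "'e list \<Rightarrow> 'v set \<Rightarrow> 'e list \<Rightarrow> ('v, 'e, 'r) lpa_poly" where
  "mon es B fs = sS es * gP B * sS' fs"

lemma chain_edges: "chain es \<Longrightarrow> set es \<subseteq> edges G"
  by (simp add: chain_def)

lemma chain_Nil [simp, intro]: "chain []"
  by (simp add: chain_def)

lemma chain_Cons: "chain (e # es) \<longleftrightarrow> e \<in> edges G \<and> chain es \<and> (es = [] \<or> src G (hd es) \<in> rng G e)"
  by (auto simp: chain_def successively_Cons)

lemma chain_singleton [simp]: "chain [e] \<longleftrightarrow> e \<in> edges G"
  by (simp add: chain_def)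

lemma chain_snoc:
  "chain (es @ [e]) \<longleftrightarrow> e \<in> edges G \<and> chain es \<and> (es = [] \<or> src G e \<in> rng G (last es))"
  by (auto simp: chain_def successively_append_iff)

lemma is_path_EPath_iff: "is_path G (EPath es) \<longleftrightarrow> es \<noteq> [] \<and> chain es"
  by (auto simp: chain_def successively_conv_nth)

lemma sS_simps [simp]:
  "sS [] = 1" "sS (e # es) = gS e * sS es" "sS (es @ es') = sS es * sS es'"
  "sS' [] = 1" "sS' (e # es) = sS' es * gS' e" "sS' (es @ es') = sS' es' * sS' es"
  by (simp_all add: sS_def sS'_def)

lemma sS_in_F [simp, intro]: "set es \<subseteq> edges G \<Longrightarrow> sS es \<in> F" "set es \<subseteq> edges G \<Longrightarrow> sS' es \<in> F"
  by (induction es) auto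

lemma mon_in_F [simp, intro]:
  "set es \<subseteq> edges G \<Longrightarrow> B \<in> gverts G \<Longrightarrow> set fs \<subseteq> edges G \<Longrightarrow> mon es B fs \<in> F"
  by (auto simp: mon_def)

lemma hcomp_sS:
  "es \<noteq> [] \<Longrightarrow> set es \<subseteq> edges G \<Longrightarrow> sS es \<in> hcomp G (int (length es))"
proof (induction es rule: list_nonempty_induct)
  case (cons e es)
  then have "gS e * sS es \<in> hcomp G (1 + int (length es))"
    by (intro hcomp_mult hcomp_gen) auto
  then show ?case by simp
qed (auto intro: hcomp_gen)

lemma hcomp_sS':
  "es \<noteq> [] \<Longrightarrow> set es \<subseteq> edges G \<Longrightarrow> sS' es \<in> hcomp G (- int (length es))"
proof (induction es rule: list_nonempty_induct)
  case (cons e es)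
  then have "sS' es * gS' e \<in> hcomp G (- int (length es) + (- 1))"
    by (intro hcomp_mult hcomp_gen) auto
  then show ?case by (simp add: algebra_simps)
qed (auto intro: hcomp_gen)

lemma hcomp_P [intro]: "A \<in> gverts G \<Longrightarrow> gP A \<in> hcomp G 0"
  by (rule hcomp_gen) auto

lemma hcomp_mon:
  assumes "set es \<subseteq> edges G" "B \<in> gverts G" "set fs \<subseteq> edges G"
  shows "mon es B fs \<in> hcomp G (int (length es) - int (length fs))"
proof -
  have "sS es * gP B \<in> hcomp G (int (length es))"
    using assms hcomp_mult[OF hcomp_sS hcomp_P, of es B] by (cases "es = []") auto
  then show ?thesis
    using assms hcomp_mult[OF _ hcomp_sS', of "sS es * gP B" "int (length es)" fs]
    by (cases "fs = []") (auto simp: mon_def)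
qed

text \<open>The linear span of the monomials of degree \<open>n\<close> modulo the ideal. Monomials
  are added one at a time for the sake of induction, and starting from any element of the ideal
  makes the span closed under congruence.\<close>

inductive_set mspan :: "int \<Rightarrow> ('v, 'e, 'r) lpa_poly set" for n where
  ideal: "f \<in> I \<Longrightarrow> f \<in> mspan n"
| mon: "f \<in> mspan n \<Longrightarrow> chain es \<Longrightarrow> B \<in> gverts G \<Longrightarrow> chain fs \<Longrightarrow>
    int (length es) - int (length fs) = n \<Longrightarrow> f + scal c * mon es B fs \<in> mspan n"

lemma mspan_add:
  assumes "f \<in> mspan n" "g \<in> mspan n"
  shows "f + g \<in> mspan n"
  using assms(2)
proof (induction rule: mspan.induct)
  case (ideal g)
  show ?case
    using assms(1) ideal
  proof (induction rule: mspan.induct)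
    case (mon f es B fs c)
    then have "(f + g) + scal c * mon es B fs \<in> mspan n"
      by (intro mspan.mon) auto
    then show ?case by (simp add: algebra_simps)
  qed (auto intro: mspan.ideal ideal_add)
next
  case (mon g es B fs c)
  then have "(f + g) + scal c * mon es B fs \<in> mspan n"
    by (intro mspan.mon) auto
  then show ?case by (simp add: algebra_simps)
qed

lemma mspan_cong: "g \<sim> f \<Longrightarrow> f \<in> mspan n \<Longrightarrow> g \<in> mspan n"
  using mspan_add[of f n "g - f"] by (auto simp: eqv_def mspan.ideal)

lemma mspan_zero [simp, intro]: "0 \<in> mspan n"
  by (simp add: mspan.ideal ideal_zero)

lemma mspan_mon:
  "chain es \<Longrightarrow> B \<in> gverts G \<Longrightarrow> chain fs \<Longrightarrow> int (length es) - int (length fs) = n \<Longrightarrow>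
    mon es B fs \<in> mspan n"
  using mspan.mon[of 0 n es B fs 1] by simp

lemma mspan_scal_mult: "f \<in> mspan n \<Longrightarrow> scal c * f \<in> mspan n"
proof (induction rule: mspan.induct)
  case (mon f es B fs d)
  then have "scal c * f + scal (c * d) * mon es B fs \<in> mspan n"
    by (intro mspan.mon) auto
  then show ?case
    by (simp add: algebra_simps scal_def mult_single flip: mult.assoc)
qed (auto intro: mspan.ideal ideal_mult_left)

text \<open>The projection merges with \<open>gP B\<close> if \<open>es\<close> is empty. Otherwise
  it meets the first edge of \<open>es\<close>, which absorbs it or is killed by it.\<close>

lemma P_mon_in_mspan:
  assumes "C \<in> gverts G" "chain es" "B \<in> gverts G" "chain fs"
  shows "gP C * mon es B fs \<in> mspan (int (length es) - int (length fs))"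
proof (cases es)
  case Nil
  have "gP C * mon es B fs = gP C * gP B * sS' fs"
    by (simp add: Nil mon_def mult.assoc)
  also have "\<dots> \<sim> gP (C \<inter> B) * sS' fs"
    using assms chain_edges by (intro eqv_multL eqv_P_P) auto
  also have "\<dots> = mon es (C \<inter> B) fs"
    by (simp add: Nil mon_def)
  finally show ?thesis
    by (rule mspan_cong) (use assms in \<open>auto intro: mspan_mon\<close>)
next
  case (Cons e es')
  with assms chain_edges[of es] have e: "e \<in> edges G" "set es' \<subseteq> edges G"
    by auto
  have "gP C * mon es B fs = gP C * gS e * mon es' B fs"
    by (simp add: Cons mon_def mult.assoc)
  also have "\<dots> \<sim> (if src G e \<in> C then gS e else 0) * mon es' B fs"
    using assms chain_edges[of fs] e by (intro eqv_multL eqv_P_S) auto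
  also have "\<dots> = (if src G e \<in> C then mon es B fs else 0)"
    by (simp add: Cons mon_def mult.assoc)
  finally show ?thesis
    by (rule mspan_cong) (use assms in \<open>auto intro: mspan_mon\<close>)
qed

text \<open>Either \<open>e # es\<close> is again a path, or the first two edges do not compose and
  the product vanishes modulo the ideal.\<close>

lemma S_mon_in_mspan:
  assumes "e \<in> edges G" "chain es" "B \<in> gverts G" "chain fs"
  shows "gS e * mon es B fs \<in> mspan (1 + (int (length es) - int (length fs)))"
proof (cases "chain (e # es)")
  case True
  have "gS e * mon es B fs = mon (e # es) B fs"
    by (simp add: mon_def mult.assoc)
  with True assms show ?thesis
    by (auto intro: mspan_mon)
next
  case False
  with assms obtain f es' where es: "es = f # es'" and f: "src G f \<notin> rng G e" "f \<in> edges G"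
      "set es' \<subseteq> edges G"
    using chain_edges[of es] by (cases es) (auto simp: chain_Cons)
  have "gS e * mon es B fs = gS e * gS f * mon es' B fs"
    by (simp add: es mon_def mult.assoc)
  also have "\<dots> \<sim> 0 * mon es' B fs"
    using assms chain_edges[of fs] f by (intro eqv_multL eqv_S_S_zero) auto
  also have "\<dots> = 0"
    by simp
  finally show ?thesis
    by (rule mspan_cong) auto
qed

text \<open>If \<open>es\<close> is nonempty, its first edge cancels against the ghost edge, which
  leaves a projection in front or 0. If \<open>es\<close> is empty, the ghost edge meets
  \<open>gP B\<close> and, unless killed, goes on to extend the ghost path.\<close>

lemma S'_mon_in_mspan:
  assumes "e \<in> edges G" "chain es" "B \<in> gverts G" "chain fs"
  shows "gS' e * mon es B fs \<in> mspan (- 1 + (int (length es) - int (length fs)))"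
proof (cases es)
  case (Cons f es')
  with assms have f: "f \<in> edges G" "chain es'" "set es' \<subseteq> edges G"
    using chain_edges[of es] by (auto simp: chain_Cons)
  have "gS' e * mon es B fs = gS' e * gS f * mon es' B fs"
    by (simp add: Cons mon_def mult.assoc)
  also have "\<dots> \<sim> (if e = f then gP (rng G e) else 0) * mon es' B fs"
    using assms chain_edges[of fs] f by (intro eqv_multL eqv_S'_S) auto
  also have "\<dots> = (if e = f then gP (rng G e) * mon es' B fs else 0)"
    by simp
  finally show ?thesis
    by (rule mspan_cong) (use assms f P_mon_in_mspan[of "rng G e" es' B fs] in \<open>auto simp: Cons\<close>)
next
  case Nil
  have "gS' e * mon es B fs = gS' e * gP B * sS' fs"
    by (simp add: Nil mon_def mult.assoc)
  also have "\<dots> \<sim> (if src G e \<in> B then gS' e else 0) * sS' fs"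
    using assms chain_edges[of fs] by (intro eqv_multL eqv_S'_P) auto
  also have "\<dots> = (if src G e \<in> B then gS' e * sS' fs else 0)"
    by simp
  finally have *: "gS' e * mon es B fs \<sim> (if src G e \<in> B then gS' e * sS' fs else 0)" .
  have "gS' e * sS' fs \<in> mspan (- 1 - int (length fs))"
  proof (cases "chain (fs @ [e])")
    case True
    \<comment> \<open>Ghost paths are written in reverse, so \<open>e\<close> becomes the last edge
      of \<open>fs @ [e]\<close>; \<open>gP (rng G e)\<close> is inserted to serve as the middle
      projection.\<close>
    have "gS' e * sS' fs \<sim> gP (rng G e) * gS' e * sS' fs"
      using assms chain_edges[of fs] by (intro eqv_multL eqv_sym[OF eqv_rng_S']) auto
    also have "\<dots> = mon [] (rng G e) (fs @ [e])"
      by (simp add: mon_def mult.assoc)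
    finally show ?thesis
      by (rule mspan_cong) (use True assms(1) in \<open>auto intro: mspan_mon\<close>)
  next
    case False
    with assms obtain f fs' where fs: "fs = fs' @ [f]" and f: "src G e \<notin> rng G f" "f \<in> edges G"
      "set fs' \<subseteq> edges G"
      using chain_edges[of fs] by (cases fs rule: rev_cases) (auto simp: chain_snoc simp flip: append_assoc)
    have "gS' e * sS' fs = gS' e * gS' f * sS' fs'"
      by (simp add: fs mult.assoc)
    also have "\<dots> \<sim> 0 * sS' fs'"
      using assms f by (intro eqv_multL eqv_S'_S'_zero) auto
    also have "\<dots> = 0" by simp
    finally show ?thesis
      by (rule mspan_cong) auto
  qed
  then show ?thesis
    by (intro mspan_cong[OF *]) (auto simp: Nil)
qed

lemma gen_mult_mspan:
  assumes "x \<in> lpa_gens G" "f \<in> mspan n"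
  shows "gen x * f \<in> mspan (gen_deg x + n)"
  using assms(2)
proof (induction rule: mspan.induct)
  case (ideal f)
  with assms(1) show ?case
    by (intro mspan.ideal ideal_mult_left) auto
next
  case (mon f es B fs c)
  have "gen x * mon es B fs \<in> mspan (gen_deg x + n)"
    using assms(1) mon S_mon_in_mspan[of _ es B fs] S'_mon_in_mspan[of _ es B fs]
      P_mon_in_mspan[of _ es B fs]
    by (cases x) simp_all
  then have "gen x * f + scal c * (gen x * mon es B fs) \<in> mspan (gen_deg x + n)"
    using mon.IH by (intro mspan_add mspan_scal_mult)
  moreover have "gen x * (scal c * mon es B fs) = scal c * (gen x * mon es B fs)"
    by (simp add: scal_commute[of c "gen x"] flip: mult.assoc)
  ultimately show ?case
    by (simp add: distrib_left)
qed

lemma gen_in_mspan: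
  assumes "x \<in> lpa_gens G"
  shows "gen x \<in> mspan (gen_deg x)"
proof (cases x)
  case (Edge e)
  with assms have "mon [e] (rng G e) [] \<in> mspan 1"
    by (intro mspan_mon) (auto simp: chain_Cons)
  then show ?thesis
    using assms Edge eqv_sym[OF eqv_S_rng, of e] mspan_cong[of "gS e"] by (simp add: mon_def)
next
  case (Ghost e)
  with assms have "mon [] (rng G e) [e] \<in> mspan (- 1)"
    by (intro mspan_mon) (auto simp: chain_Cons)
  then show ?thesis
    using assms Ghost eqv_sym[OF eqv_rng_S', of e] mspan_cong[of "gS' e"] by (simp add: mon_def)
next
  case (Proj A)
  with assms have "mon [] A [] \<in> mspan 0"
    by (intro mspan_mon) auto
  then show ?thesis
    using Proj by (simp add: mon_def)
qed

lemma single_in_mspan: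
  assumes "set (letters w) \<subseteq> lpa_gens G" "w \<noteq> 0"
  shows "Poly_Mapping.single w c \<in> mspan (word_deg w)"
proof -
  \<comment> \<open>The word is built from its last letter by left multiplication with generators.
    The induction starts from one letter, since the empty word stands for the unit, which the
    algebra need not contain.\<close>
  have "Poly_Mapping.single (Word xs) 1 \<in> mspan (word_deg (Word xs))"
    if "xs \<noteq> []" "set xs \<subseteq> lpa_gens G" for xs
    using that
  proof (induction xs rule: list_nonempty_induct)
    case (single x)
    then show ?case
      using gen_in_mspan[of x] by (simp add: gen_def)
  next
    case (cons x xs)
    then have "gen x * Poly_Mapping.single (Word xs) 1 \<in> mspan (gen_deg x + word_deg (Word xs))"
      by (intro gen_mult_mspan) auto
    then show ?case
      by (simp add: gen_mult_single word_deg_def plus_word_def)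
  qed
  from mspan_scal_mult[OF this[of "letters w"], of c] assms show ?thesis
    by (simp add: scal_def mult_single)
qed

lemma hcomp_subset_mspan: "hcomp G n \<subseteq> mspan n"
proof
  fix f :: "('v, 'e, 'r) lpa_poly"
  assume f: "f \<in> hcomp G n"
  then have "Poly_Mapping.single w (Poly_Mapping.lookup f w) \<in> mspan n" if "w \<in> Poly_Mapping.keys f" for w
    using that single_in_mspan[of w] by (auto simp: hcomp_def)
  then have "(\<Sum>w\<in>A. Poly_Mapping.single w (Poly_Mapping.lookup f w)) \<in> mspan n"
    if "A \<subseteq> Poly_Mapping.keys f" for A
    using that by (induction A rule: infinite_finite_induct) (auto intro: mspan_add)
  from this[of "Poly_Mapping.keys f"] show "f \<in> mspan n"
    by (simp flip: poly_mapping_eq_sum_single)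
qed

section \<open>The components as images of homogeneous polynomials\<close>

lemma path_elem_in_hcomp:
  assumes "\<alpha> \<in> paths G"
  shows "(path_elem \<alpha> :: ('v, 'e, 'r) lpa_poly) \<in> hcomp G (int (path_length \<alpha>))"
    and "(path_elem' \<alpha> :: ('v, 'e, 'r) lpa_poly) \<in> hcomp G (- int (path_length \<alpha>))"
proof (atomize(full), cases \<alpha>)
  case (GVert A)
  with assms have "A \<in> gverts G"
    by (simp add: paths_def)
  then show "(path_elem \<alpha> :: ('v, 'e, 'r) lpa_poly) \<in> hcomp G (int (path_length \<alpha>)) \<and>
      (path_elem' \<alpha> :: ('v, 'e, 'r) lpa_poly) \<in> hcomp G (- int (path_length \<alpha>))"
    by (simp add: GVert hcomp_P)
next
  case (EPath es)
  with assms have "es \<noteq> []" "set es \<subseteq> edges G"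
    by (auto simp: paths_def is_path_EPath_iff simp del: is_path.simps(2) dest: chain_edges)
  from hcomp_sS[OF this] hcomp_sS'[OF this]
  show "(path_elem \<alpha> :: ('v, 'e, 'r) lpa_poly) \<in> hcomp G (int (path_length \<alpha>)) \<and>
      (path_elem' \<alpha> :: ('v, 'e, 'r) lpa_poly) \<in> hcomp G (- int (path_length \<alpha>))"
    by (simp add: EPath sS_def sS'_def)
qed

definition sum_mon :: "('r \<times> ('v, 'e) upath \<times> 'v set \<times> ('v, 'e) upath) list \<Rightarrow> ('v, 'e, 'r) lpa_poly"
  where "sum_mon ts = (\<Sum>(c, \<alpha>, A, \<beta>) \<leftarrow> ts. scal c * path_elem \<alpha> * gP A * path_elem' \<beta>)"

definition mon_list :: "int \<Rightarrow> ('r \<times> ('v, 'e) upath \<times> 'v set \<times> ('v, 'e) upath) list \<Rightarrow> bool"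
  where "mon_list n ts \<longleftrightarrow> (\<forall>(c, \<alpha>, A, \<beta>) \<in> set ts. \<alpha> \<in> paths G \<and> \<beta> \<in> paths G \<and> A \<in> gverts G \<and>
          int (path_length \<alpha>) - int (path_length \<beta>) = n)"

lemma sum_mon_in_hcomp: "mon_list n ts \<Longrightarrow> sum_mon ts \<in> hcomp G n"
proof (induction ts)
  case (Cons t ts)
  obtain c \<alpha> A \<beta> where t: "t = (c, \<alpha>, A, \<beta>)" by (cases t)
  with Cons.prems have *: "\<alpha> \<in> paths G" "\<beta> \<in> paths G" "A \<in> gverts G"
    "n = int (path_length \<alpha>) + 0 + - int (path_length \<beta>)"
    by (auto simp: mon_list_def)
  have "scal c * (path_elem \<alpha> * gP A * path_elem' \<beta>) \<in> hcomp G n"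
    unfolding *(4) using *(1-3)
    by (intro hcomp_scal_mult hcomp_mult path_elem_in_hcomp hcomp_P)
  moreover have "sum_mon ts \<in> hcomp G n"
    using Cons by (simp add: mon_list_def)
  ultimately show ?case
    using hcomp_add by (simp add: sum_mon_def t mult.assoc)
qed (simp add: sum_mon_def)

lemma mspan_eqv_sum_mon:
  assumes "f \<in> mspan n"
  shows "\<exists>ts. mon_list n ts \<and> f \<sim> sum_mon ts"
  using assms
proof (induction rule: mspan.induct)
  case (ideal f)
  then show ?case
    by (intro exI[of _ "[]"]) (simp add: mon_list_def sum_mon_def flip: ideal_iff_eqv_zero)
next
  case (mon f es B fs c)
  then obtain ts where ts: "mon_list n ts" "f \<sim> sum_mon ts"
    by blast
  \<comment> \<open>An empty edge list stands for a path of length 0, for which \<open>B\<close>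
    itself is taken; the additional factors \<open>gP B\<close> are harmless since
    \<open>gP B\<close> is idempotent modulo the ideal.\<close>
  define \<alpha> :: "('v, 'e) upath" where "\<alpha> = (if es = [] then GVert B else EPath es)"
  define \<beta> :: "('v, 'e) upath" where "\<beta> = (if fs = [] then GVert B else EPath fs)"
  have P: "gP B * gP B \<sim> gP B"
    using eqv_P_P[OF \<open>B \<in> gverts G\<close> \<open>B \<in> gverts G\<close>] by simp
  have es: "set es \<subseteq> edges G" "set fs \<subseteq> edges G"
    using mon chain_edges by auto
  have F: "path_elem \<alpha> \<in> F" "path_elem' \<beta> \<in> F"
    using es \<open>B \<in> gverts G\<close> by (auto simp: \<alpha>_def \<beta>_def simp flip: sS_def sS'_def)
  have "sS es * gP B \<sim> path_elem \<alpha> * gP B"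
    using eqv_sym[OF P] es \<open>B \<in> gverts G\<close> by (cases "es = []") (simp_all add: \<alpha>_def flip: sS_def)
  then have "mon es B fs \<sim> path_elem \<alpha> * gP B * sS' fs"
    unfolding mon_def by (rule eqv_multL) (use es in auto)
  also have "\<dots> = path_elem \<alpha> * (gP B * sS' fs)"
    by (simp add: mult.assoc)
  also have "\<dots> \<sim> path_elem \<alpha> * (gP B * path_elem' \<beta>)"
    using eqv_sym[OF P] es \<open>B \<in> gverts G\<close> F
    by (intro eqv_multR[OF _ F(1)]) (cases "fs = []"; simp add: \<beta>_def flip: sS'_def)
  finally have "scal c * mon es B fs \<sim> scal c * (path_elem \<alpha> * (gP B * path_elem' \<beta>))"
    by (rule eqv_multR) auto
  then have "f + scal c * mon es B fs \<sim> sum_mon ((c, \<alpha>, B, \<beta>) # ts)"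
    using eqv_add[OF _ ts(2)] by (simp add: sum_mon_def mult.assoc add.commute[of f])
  moreover have "mon_list n ((c, \<alpha>, B, \<beta>) # ts)"
    using ts(1) mon by (auto simp: mon_list_def \<alpha>_def \<beta>_def paths_def is_path_EPath_iff
      simp del: is_path.simps(2))
  ultimately show ?case by blast
qed

text \<open>Path monomials are homogeneous polynomials, and conversely homogeneous polynomials
  reduce to combinations of path monomials modulo the ideal. With \<open>hcomp\<close>, products of
  components become transparent, since words are just concatenated.\<close>

lemma lpa_component_eq: "(lpa_component G n :: ('v, 'e, 'r) lpa_poly set set) = lpa_class G ` hcomp G n"
proof -
  have "(lpa_component G n :: ('v, 'e, 'r) lpa_poly set set) = {lpa_class G (sum_mon ts) |ts. mon_list n ts}"
    by (simp add: lpa_component_def sum_mon_def mon_list_def)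
  also have "\<dots> = lpa_class G ` hcomp G n"
  proof (intro equalityI subsetI)
    fix x assume "x \<in> lpa_class G ` (hcomp G n :: ('v, 'e, 'r) lpa_poly set)"
    then obtain f :: "('v, 'e, 'r) lpa_poly" where f: "f \<in> hcomp G n" "x = lpa_class G f" by blast
    then obtain ts where "mon_list n ts" "f \<sim> sum_mon ts"
      using mspan_eqv_sum_mon hcomp_subset_mspan by blast
    then show "x \<in> {lpa_class G (sum_mon ts) |ts. mon_list n ts}"
      using f(2) lpa_class_eq_iff eqv_in_F by blast
  qed (use sum_mon_in_hcomp in blast)
  finally show ?thesis .
qed

end

section \<open>The grading\<close>

context leavitt
begin

lemma ideal_sum: "(\<And>i. i \<in> A \<Longrightarrow> f i \<in> I) \<Longrightarrow> sum f A \<in> I"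
  by (induction A rule: infinite_finite_induct) (simp_all add: ideal_zero ideal_add)

lemma hcomp_diff: "f \<in> hcomp G n \<Longrightarrow> g \<in> hcomp G n \<Longrightarrow> f - g \<in> hcomp G n"
  using hcomp_add[of f G n "- g"] hcomp_uminus[of g G n] by simp

lemma hcomp_gS [intro]: "e \<in> edges G \<Longrightarrow> gS e \<in> hcomp G 1"
  by (rule hcomp_gen) simp_all

lemma hcomp_gS' [intro]: "e \<in> edges G \<Longrightarrow> gS' e \<in> hcomp G (- 1)"
  by (rule hcomp_gen) simp_all

text \<open>This is what makes the defining ideal homogeneous: each relation has degree 0, 1 or
  -1.\<close>

lemma relation_homogeneous:
  fixes f :: "('v, 'e, 'r) lpa_poly"
  assumes "f \<in> lpa_relations G"
  shows "\<exists>n. f \<in> hcomp G n"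
proof -
  have PP: "gP A * gP B \<in> (hcomp G 0 :: ('v, 'e, 'r) lpa_poly set)"
    if "A \<in> gverts G" "B \<in> gverts G" for A B
    using hcomp_mult[OF hcomp_P hcomp_P] that by fastforce
  have PS: "gP A * gS e \<in> (hcomp G 1 :: ('v, 'e, 'r) lpa_poly set)"
    "gS e * gP A \<in> (hcomp G 1 :: ('v, 'e, 'r) lpa_poly set)"
    if "A \<in> gverts G" "e \<in> edges G" for A e
    using hcomp_mult[OF hcomp_P hcomp_gS] hcomp_mult[OF hcomp_gS hcomp_P] that by fastforce+
  have PS': "gP A * gS' e \<in> (hcomp G (- 1) :: ('v, 'e, 'r) lpa_poly set)"
    "gS' e * gP A \<in> (hcomp G (- 1) :: ('v, 'e, 'r) lpa_poly set)"
    if "A \<in> gverts G" "e \<in> edges G" for A e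
    using hcomp_mult[OF hcomp_P hcomp_gS'] hcomp_mult[OF hcomp_gS' hcomp_P] that by fastforce+
  have SS': "gS e * gS' f \<in> (hcomp G 0 :: ('v, 'e, 'r) lpa_poly set)"
    "gS' e * gS f \<in> (hcomp G 0 :: ('v, 'e, 'r) lpa_poly set)"
    if "e \<in> edges G" "f \<in> edges G" for e f
    using hcomp_mult[OF hcomp_gS hcomp_gS'] hcomp_mult[OF hcomp_gS' hcomp_gS] that by fastforce+
  have 1: "gP {} \<in> (hcomp G 0 :: ('v, 'e, 'r) lpa_poly set)"
    by (rule hcomp_P) simp
  have 2: "gP A * gP B - gP (A \<inter> B) \<in> (hcomp G 0 :: ('v, 'e, 'r) lpa_poly set)"
    if "A \<in> gverts G" "B \<in> gverts G" for A B
    using that by (intro hcomp_diff PP hcomp_P) simp_all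
  have 3: "gP (A \<union> B) - (gP A + gP B - gP (A \<inter> B)) \<in> (hcomp G 0 :: ('v, 'e, 'r) lpa_poly set)"
    if "A \<in> gverts G" "B \<in> gverts G" for A B
    using that by (intro hcomp_diff hcomp_add hcomp_P) simp_all
  have 4: "gP {src G e} * gS e - gS e \<in> (hcomp G 1 :: ('v, 'e, 'r) lpa_poly set)"
    "gS e * gP (rng G e) - gS e \<in> (hcomp G 1 :: ('v, 'e, 'r) lpa_poly set)"
    "gP (rng G e) * gS' e - gS' e \<in> (hcomp G (- 1) :: ('v, 'e, 'r) lpa_poly set)"
    "gS' e * gP {src G e} - gS' e \<in> (hcomp G (- 1) :: ('v, 'e, 'r) lpa_poly set)"
    if "e \<in> edges G" for e
    using that by (intro hcomp_diff PS PS' hcomp_gS hcomp_gS' gverts_src gverts_intros; assumption)+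
  have 5: "gS' e * gS f - (if e = f then gP (rng G e) else 0) \<in> (hcomp G 0 :: ('v, 'e, 'r) lpa_poly set)"
    if "e \<in> edges G" "f \<in> edges G" for e f
    using that by (intro hcomp_diff SS') (simp_all add: hcomp_P)
  have 6: "gP {v} - (\<Sum>e \<in> {e \<in> edges G. src G e = v}. gS e * gS' e)
      \<in> (hcomp G 0 :: ('v, 'e, 'r) lpa_poly set)" if "v \<in> verts G" for v
    using that by (intro hcomp_diff hcomp_sum SS' hcomp_P gverts.vertex) simp_all
  show ?thesis
    using assms unfolding lpa_relations_def Un_iff mem_Collect_eq singleton_iff
    by (elim disjE exE conjE; hypsubst) (rule exI, rule 1 2 3 4 5 6; assumption)+
qed

lemma hpart_in_ideal:
  assumes "f \<in> I"
  shows "hpart n f \<in> I"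
proof -
  \<comment> \<open>All degrees are treated at once because factors shift degrees: a word
    \<open>u\<close> of \<open>a\<close> contributes to part \<open>n\<close> of the product through
    part \<open>n - word_deg u\<close> of \<open>f\<close>.\<close>
  have "\<forall>n. hpart n f \<in> I"
    using assms
  proof (induction rule: lpa_ideal_induct)
    case (relation f)
    with relation_homogeneous obtain m where "f \<in> hcomp G m" by blast
    then show ?case
      using relation_in_ideal[OF relation] by (simp add: hpart_hcomp ideal_zero)
  next
    case (mult_left a f)
    have "hpart n ((\<Sum>w\<in>Poly_Mapping.keys a. Poly_Mapping.single w (Poly_Mapping.lookup a w)) * f) \<in> I" for n
      unfolding sum_distrib_right hpart_sum hpart_single_mult
      by (rule ideal_sum, rule ideal_mult_left)
        (use mult_left in \<open>auto simp: in_free_algebra_iff\<close>)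
    then show ?case
      by (simp flip: poly_mapping_eq_sum_single)
  next
    case (mult_right a f)
    have "hpart n (f * (\<Sum>w\<in>Poly_Mapping.keys a. Poly_Mapping.single w (Poly_Mapping.lookup a w))) \<in> I" for n
      unfolding sum_distrib_left hpart_sum hpart_mult_single
      by (rule ideal_sum, rule ideal_mult_right)
        (use mult_right in \<open>auto simp: in_free_algebra_iff\<close>)
    then show ?case
      by (simp flip: poly_mapping_eq_sum_single)
  qed (simp_all add: ideal_zero ideal_add hpart_add)
  then show ?thesis by blast
qed

section \<open>Sums and products in the Leavitt path algebra\<close>

abbreviation L :: "('v, 'e, 'r) lpa_poly set ring" where
  "L \<equiv> lpa G"

abbreviation cls :: "('v, 'e, 'r) lpa_poly \<Rightarrow> ('v, 'e, 'r) lpa_poly set" where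
  "cls \<equiv> lpa_class G"

definition F0 :: "('v, 'e, 'r) lpa_poly set" where
  "F0 = {f \<in> F. Poly_Mapping.lookup f 0 = 0}"

lemma F0_in_F: "f \<in> F0 \<Longrightarrow> f \<in> F"
  by (simp add: F0_def)

lemma hcomp_in_F: "(f :: ('v, 'e, 'r) lpa_poly) \<in> hcomp G n \<Longrightarrow> f \<in> F"
  using hcomp_subset by blast

lemma hcomp_in_F0: "f \<in> hcomp G n \<Longrightarrow> f \<in> F0"
  by (simp add: F0_def hcomp_in_F hcomp_lookup_zero)

lemma hcomp_mult_in_F0: "f \<in> hcomp G m \<Longrightarrow> g \<in> hcomp G n \<Longrightarrow> f * g \<in> F0"
  by (rule hcomp_in_F0) (rule hcomp_mult)

lemma F0_closed:
  "0 \<in> F0" "f \<in> F0 \<Longrightarrow> g \<in> F0 \<Longrightarrow> f + g \<in> F0" "f \<in> F0 \<Longrightarrow> - f \<in> F0"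
  by (auto simp: F0_def lookup_add)

lemma F0_sum: "(\<And>i. i \<in> A \<Longrightarrow> f i \<in> F0) \<Longrightarrow> sum f A \<in> F0"
  by (induction A rule: infinite_finite_induct) (simp_all add: F0_closed)

lemma carrier_L: "carrier L = cls ` F0"
  by (auto simp: lpa_def F0_def)

lemma zero_L: "\<zero>\<^bsub>L\<^esub> = cls 0"
  by (simp add: lpa_def FactRing_def lpa_class_def a_r_coset_def r_coset_def free_algebra_ops)

lemma add_L: "f \<in> F \<Longrightarrow> g \<in> F \<Longrightarrow> cls f \<oplus>\<^bsub>L\<^esub> cls g = cls (f + g)"
  using ideal.a_rcos_sum[OF ideal_lpa_ideal, of f g]
  by (simp add: lpa_def FactRing_def lpa_class_def free_algebra_ops)

lemma mult_L: "f \<in> F \<Longrightarrow> g \<in> F \<Longrightarrow> cls f \<otimes>\<^bsub>L\<^esub> cls g = cls (f * g)"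
  using ideal.rcoset_mult_add[OF ideal_lpa_ideal, of f g]
  by (simp add: lpa_def FactRing_def lpa_class_def free_algebra_ops)

lemma mult_L_hcomp: "f \<in> hcomp G m \<Longrightarrow> g \<in> hcomp G n \<Longrightarrow> cls f \<otimes>\<^bsub>L\<^esub> cls g = cls (f * g)"
  by (simp add: mult_L[OF hcomp_in_F hcomp_in_F])

text \<open>Finite sums in \<open>L\<close> rest on its additive group alone; \<open>L\<close> need
  not have a unit.\<close>

lemma abelian_group_L: "abelian_group L"
proof (rule abelian_groupI)
  show "\<zero>\<^bsub>L\<^esub> \<in> carrier L"
    by (simp add: carrier_L zero_L F0_closed)
  fix x assume "x \<in> carrier L"
  then obtain f where f: "f \<in> F0" "x = cls f"
    by (auto simp: carrier_L)
  show "\<zero>\<^bsub>L\<^esub> \<oplus>\<^bsub>L\<^esub> x = x"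
    using f by (simp add: zero_L add_L F0_in_F)
  show "\<exists>y\<in>carrier L. y \<oplus>\<^bsub>L\<^esub> x = \<zero>\<^bsub>L\<^esub>"
    using f by (intro bexI[of _ "cls (- f)"]) (auto simp: zero_L add_L F0_in_F carrier_L F0_closed)
  fix y assume "y \<in> carrier L"
  then obtain g where g: "g \<in> F0" "y = cls g"
    by (auto simp: carrier_L)
  show "x \<oplus>\<^bsub>L\<^esub> y \<in> carrier L"
    using f g by (auto simp: add_L F0_in_F carrier_L F0_closed)
  show "x \<oplus>\<^bsub>L\<^esub> y = y \<oplus>\<^bsub>L\<^esub> x"
    using f g by (simp add: add_L F0_in_F add.commute)
  fix z assume "z \<in> carrier L"
  then obtain h where h: "h \<in> F0" "z = cls h"
    by (auto simp: carrier_L)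
  show "x \<oplus>\<^bsub>L\<^esub> y \<oplus>\<^bsub>L\<^esub> z = x \<oplus>\<^bsub>L\<^esub> (y \<oplus>\<^bsub>L\<^esub> z)"
    using f g h by (simp add: add_L F0_in_F add.assoc)
qed

interpretation L: abelian_group L
  by (rule abelian_group_L)

lemma finsum_L:
  "finite A \<Longrightarrow> (\<And>i. i \<in> A \<Longrightarrow> f i \<in> F0) \<Longrightarrow> finsum L (\<lambda>i. cls (f i)) A = cls (sum f A)"
proof (induction A rule: finite_induct)
  case (insert i A)
  then have "finsum L (\<lambda>i. cls (f i)) (insert i A) = cls (f i) \<oplus>\<^bsub>L\<^esub> finsum L (\<lambda>i. cls (f i)) A"
    by (intro L.finsum_insert) (auto simp: carrier_L)
  with insert show ?case
    by (simp add: add_L F0_in_F F0_sum)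
qed (simp add: zero_L)

lemma a_inv_L: "f \<in> F0 \<Longrightarrow> \<ominus>\<^bsub>L\<^esub> cls f = cls (- f)"
  by (rule L.minus_equality) (auto simp: add_L F0_in_F zero_L carrier_L F0_closed)

text \<open>The full preimage in \<open>F\<close> of the product of the components of degrees
  \<open>m\<close> and \<open>n\<close>. Membership of a class in that product thus becomes
  membership of a polynomial here.\<close>

inductive_set sprod :: "int \<Rightarrow> int \<Rightarrow> ('v, 'e, 'r) lpa_poly set" for m n where
  ideal: "f \<in> I \<Longrightarrow> f \<in> sprod m n"
| mult: "f \<in> sprod m n \<Longrightarrow> a \<in> hcomp G m \<Longrightarrow> b \<in> hcomp G n \<Longrightarrow> f + a * b \<in> sprod m n"

lemma sprod_in_F: "f \<in> sprod m n \<Longrightarrow> f \<in> F"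
  by (induction rule: sprod.induct) (simp_all add: ideal_in_F hcomp_in_F)

lemma sprod_eqv_sum:
  assumes "f \<in> sprod m n"
  shows "\<exists>(k::nat) a b. (\<forall>i<k. a i \<in> hcomp G m) \<and> (\<forall>i<k. b i \<in> hcomp G n) \<and> f \<sim> (\<Sum>i<k. a i * b i)"
  using assms
proof (induction rule: sprod.induct)
  case (ideal f)
  then show ?case
    by (intro exI[of _ 0]) (simp flip: ideal_iff_eqv_zero)
next
  case (mult f a b)
  then obtain k :: nat and a' b'
    where *: "\<forall>i<k. a' i \<in> hcomp G m" "\<forall>i<k. b' i \<in> hcomp G n" "f \<sim> (\<Sum>i<k. a' i * b' i)"
    by blast
  have "f + a * b \<sim> (\<Sum>i<k. a' i * b' i) + a * b"
    using *(3) mult by (intro eqv_add eqv_refl) (simp_all add: hcomp_in_F)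
  \<comment> \<open>The new product is appended at index \<open>k\<close>, which the old sum does
    not use.\<close>
  also have "\<dots> = (\<Sum>i<Suc k. (a'(k := a)) i * (b'(k := b)) i)"
    by simp
  finally show ?case
    using * mult
    by (intro exI[of _ "Suc k"] exI[of _ "a'(k := a)"] exI[of _ "b'(k := b)"]) (auto simp: less_Suc_eq)
qed

lemma set_prod_L:
  "set_prod L (lpa_component G m) (lpa_component G n) = cls ` sprod m n"
proof (intro equalityI subsetI)
  fix x assume "x \<in> set_prod L (lpa_component G m) (lpa_component G n)"
  then obtain k :: nat and a b where x: "x = (\<Oplus>\<^bsub>L\<^esub>i\<in>{..<k}. a i \<otimes>\<^bsub>L\<^esub> b i)"
    and "\<forall>i<k. a i \<in> cls ` hcomp G m" "\<forall>i<k. b i \<in> cls ` hcomp G n"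
    unfolding set_prod_def lpa_component_eq by blast
  then have "\<forall>i<k. \<exists>f. f \<in> hcomp G m \<and> a i = cls f" "\<forall>i<k. \<exists>f. f \<in> hcomp G n \<and> b i = cls f"
    by blast+
  then obtain f g where f: "\<And>i. i < k \<Longrightarrow> f i \<in> hcomp G m" "\<And>i. i < k \<Longrightarrow> a i = cls (f i)"
    and g: "\<And>i. i < k \<Longrightarrow> g i \<in> hcomp G n" "\<And>i. i < k \<Longrightarrow> b i = cls (g i)"
    by metis
  have "x = (\<Oplus>\<^bsub>L\<^esub>i\<in>{..<k}. cls (f i * g i))"
    unfolding x
  proof (rule L.finsum_cong')
    show "(\<lambda>i. cls (f i * g i)) \<in> {..<k} \<rightarrow> carrier L"
      using hcomp_mult_in_F0[OF f(1) g(1)] by (auto simp: carrier_L)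
  qed (simp_all add: f(2) g(2) mult_L_hcomp[OF f(1) g(1)])
  also have "\<dots> = cls (\<Sum>i<k. f i * g i)"
    by (rule finsum_L) (use hcomp_mult_in_F0[OF f(1) g(1)] in auto)
  \<comment> \<open>The factors are known to be homogeneous only for indices below \<open>k\<close>,
    so the induction runs over partial sums with \<open>j \<le> k\<close>.\<close>
  also have "(\<Sum>i<j. f i * g i) \<in> sprod m n" if "j \<le> k" for j
    using that by (induction j) (use f g in \<open>simp_all add: sprod.ideal ideal_zero sprod.mult\<close>)
  then have "cls (\<Sum>i<k. f i * g i) \<in> cls ` sprod m n"
    by blast
  finally show "x \<in> cls ` sprod m n" .
next
  fix x assume "x \<in> cls ` sprod m n"
  then obtain f where "f \<in> sprod m n" "x = cls f" by blast
  with sprod_eqv_sum obtain k :: nat and a b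
    where *: "\<forall>i<k. a i \<in> hcomp G m" "\<forall>i<k. b i \<in> hcomp G n" "f \<sim> (\<Sum>i<k. a i * b i)"
    by blast
  then have "x = cls (\<Sum>i<k. a i * b i)"
    using \<open>x = cls f\<close> eqv_in_F[OF *(3)] by (simp add: lpa_class_eq_iff)
  also have "\<dots> = (\<Oplus>\<^bsub>L\<^esub>i\<in>{..<k}. cls (a i * b i))"
    by (rule finsum_L[symmetric]) (use * in \<open>auto intro: hcomp_mult_in_F0\<close>)
  also have "\<dots> = (\<Oplus>\<^bsub>L\<^esub>i\<in>{..<k}. cls (a i) \<otimes>\<^bsub>L\<^esub> cls (b i))"
  proof (rule L.finsum_cong'[symmetric])
    show "(\<lambda>i. cls (a i * b i)) \<in> {..<k} \<rightarrow> carrier L"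
      using * by (auto simp: carrier_L intro!: imageI intro: hcomp_mult_in_F0)
    show "cls (a i) \<otimes>\<^bsub>L\<^esub> cls (b i) = cls (a i * b i)" if "i \<in> {..<k}" for i
      using * that by (intro mult_L_hcomp[of _ m _ n]) auto
  qed simp
  finally have "x = (\<Oplus>\<^bsub>L\<^esub>i\<in>{..<k}. cls (a i) \<otimes>\<^bsub>L\<^esub> cls (b i))" .
  then show "x \<in> set_prod L (lpa_component G m) (lpa_component G n)"
    unfolding set_prod_def lpa_component_eq using *(1,2)
    by (intro CollectI exI[of _ k] exI[of _ "\<lambda>i. cls (a i)"] exI[of _ "\<lambda>i. cls (b i)"]) simp
qed

lemma ideal_add_sprod:
  assumes "h \<in> I" "f \<in> sprod m n"
  shows "h + f \<in> sprod m n"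
  using assms(2)
proof (induction rule: sprod.induct)
  case (ideal f)
  with assms(1) show ?case by (intro sprod.ideal ideal_add)
next
  case (mult f a b)
  then have "h + f + a * b \<in> sprod m n" by (intro sprod.mult)
  then show ?case by (simp add: add.assoc)
qed

lemma sprod_cong: "g \<sim> f \<Longrightarrow> f \<in> sprod m n \<Longrightarrow> g \<in> sprod m n"
  using ideal_add_sprod[of "g - f" f] by (simp add: eqv_def)

lemma sprod_eqv_hcomp: "f \<in> sprod m n \<Longrightarrow> \<exists>g\<in>hcomp G (m + n). f \<sim> g"
proof (induction rule: sprod.induct)
  case (ideal f)
  then show ?case
    by (intro bexI[of _ 0]) (simp_all flip: ideal_iff_eqv_zero)
next
  case (mult f a b)
  then obtain g where "g \<in> hcomp G (m + n)" "f \<sim> g" by blast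
  with mult show ?case
    by (intro bexI[of _ "g + a * b"])
      (auto simp: hcomp_in_F intro!: eqv_add hcomp_mult)
qed

text \<open>Existence comes from the homogeneous parts of a representative. For uniqueness, two
  decompositions are represented by polynomials that differ by an element of the ideal, and the
  homogeneous parts of that element are again in the ideal.\<close>

lemma graded_L: "graded L (lpa_component G)"
  unfolding graded_def
proof (intro conjI allI ballI)
  fix n
  show "additive_subgroup (lpa_component G n) L"
  proof (rule additive_subgroup.intro, rule subgroup.intro)
    show "lpa_component G n \<subseteq> carrier (add_monoid L)"
      by (auto simp: lpa_component_eq carrier_L hcomp_in_F0)
  next
    fix x y :: "('v, 'e, 'r) lpa_poly set"
    assume "x \<in> lpa_component G n" "y \<in> lpa_component G n"
    then show "x \<otimes>\<^bsub>add_monoid L\<^esub> y \<in> lpa_component G n"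
      by (auto simp: lpa_component_eq add_L hcomp_in_F hcomp_add)
  next
    show "\<one>\<^bsub>add_monoid L\<^esub> \<in> lpa_component G n"
      by (simp add: lpa_component_eq zero_L)
  next
    fix x :: "('v, 'e, 'r) lpa_poly set"
    assume "x \<in> lpa_component G n"
    then show "inv\<^bsub>add_monoid L\<^esub> x \<in> lpa_component G n"
      unfolding a_inv_def[symmetric]
      by (auto simp: lpa_component_eq a_inv_L hcomp_in_F0 hcomp_uminus)
  qed
next
  fix m n
  show "set_prod L (lpa_component G m) (lpa_component G n) \<subseteq> lpa_component G (m + n)"
    unfolding set_prod_L unfolding lpa_component_eq
  proof
    fix x assume "x \<in> cls ` sprod m n"
    then obtain f g where "x = cls f" "g \<in> hcomp G (m + n)" "f \<sim> g"
      using sprod_eqv_hcomp by blast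
    then show "x \<in> cls ` hcomp G (m + n)"
      using eqv_in_F[of f g] lpa_class_eq_iff[of f g] by auto
  qed
next
  fix x assume "x \<in> carrier L"
  then obtain f where f: "f \<in> F0" "x = cls f"
    by (auto simp: carrier_L)
  have hf: "hpart n f \<in> hcomp G n" for n
    using f by (auto simp: F0_def intro: hpart_in_hcomp)
  let ?d = "\<lambda>n. cls (hpart n f)"
  \<comment> \<open>The finite set of degrees that occur in \<open>f\<close>. It contains every
    degree with \<open>?d n\<close> nonzero, but possibly also degrees whose part lies in the
    ideal.\<close>
  let ?S = "word_deg ` Poly_Mapping.keys f"
  have "hpart n f = 0" if "n \<notin> ?S" for n
    using that by (intro poly_mapping_eqI) (auto simp: lookup_hpart in_keys_iff)
  then have sub: "{n. ?d n \<noteq> \<zero>\<^bsub>L\<^esub>} \<subseteq> ?S"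
    by (auto simp: zero_L)
  have "(\<Sum>n\<in>?S. hpart n f) = f"
    by (rule poly_mapping_eqI) (auto simp: lookup_sum lookup_hpart sum.delta in_keys_iff)
  then have "x = (\<Oplus>\<^bsub>L\<^esub>n\<in>?S. ?d n)"
    using f finsum_L[of ?S "\<lambda>n. hpart n f", OF _ hcomp_in_F0[OF hf]] by simp
  also have "\<dots> = (\<Oplus>\<^bsub>L\<^esub>n\<in>{n. ?d n \<noteq> \<zero>\<^bsub>L\<^esub>}. ?d n)"
    by (rule L.add.finprod_mono_neutral_cong_right)
      (use sub hcomp_in_F0[OF hf] in \<open>auto simp: carrier_L\<close>)
  finally have x: "x = (\<Oplus>\<^bsub>L\<^esub>n\<in>{n. ?d n \<noteq> \<zero>\<^bsub>L\<^esub>}. ?d n)" .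
  show "\<exists>!d. (\<forall>n. d n \<in> lpa_component G n) \<and> finite {n. d n \<noteq> \<zero>\<^bsub>L\<^esub>} \<and>
      x = (\<Oplus>\<^bsub>L\<^esub>n\<in>{n. d n \<noteq> \<zero>\<^bsub>L\<^esub>}. d n)"
  proof (rule ex1I[of _ ?d], intro conjI allI)
    show "?d n \<in> lpa_component G n" for n
      using hf by (simp add: lpa_component_eq)
    show "finite {n. ?d n \<noteq> \<zero>\<^bsub>L\<^esub>}"
      using sub by (rule finite_subset) simp
    show "x = (\<Oplus>\<^bsub>L\<^esub>n\<in>{n. ?d n \<noteq> \<zero>\<^bsub>L\<^esub>}. ?d n)" by (rule x)
  next
    fix d
    assume d: "(\<forall>n. d n \<in> lpa_component G n) \<and> finite {n. d n \<noteq> \<zero>\<^bsub>L\<^esub>} \<and>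
      x = (\<Oplus>\<^bsub>L\<^esub>n\<in>{n. d n \<noteq> \<zero>\<^bsub>L\<^esub>}. d n)"
    let ?N = "{n. d n \<noteq> \<zero>\<^bsub>L\<^esub>}"
    from d have "\<forall>n. \<exists>g. g \<in> hcomp G n \<and> d n = cls g"
      by (auto simp: lpa_component_eq)
    then obtain g where g: "\<And>n. g n \<in> hcomp G n" and dg: "\<And>n. d n = cls (g n)"
      by metis
    have "cls f = cls (sum g ?N)"
      using d f finsum_L[of ?N g, OF _ hcomp_in_F0[OF g]] by (simp add: dg)
    moreover have "sum g ?N \<in> F"
      using hcomp_in_F[OF g] by (intro free_algebra_sum_closed)
    ultimately have "f - sum g ?N \<in> I"
      using f by (simp add: lpa_class_eq_iff eqv_def F0_in_F)
    then have I: "hpart n f - hpart n (sum g ?N) \<in> I" for n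
      using hpart_in_ideal[of "f - sum g ?N" n] by (simp add: hpart_diff)
    have "hpart n (sum g ?N) = (if n \<in> ?N then g n else 0)" for n
    proof -
      have "hpart n (sum g ?N) = (\<Sum>i\<in>?N. if n = i then g i else 0)"
        unfolding hpart_sum by (rule sum.cong) (auto simp: hpart_hcomp[OF g])
      with d show ?thesis by (simp add: sum.delta)
    qed
    then have "cls (hpart n f) = cls (if n \<in> ?N then g n else 0)" for n
      using I[of n] hcomp_in_F[OF hf] hcomp_in_F[OF g] by (subst lpa_class_eq_iff) (simp_all add: eqv_def)
    \<comment> \<open>Outside \<open>?N\<close> the component \<open>d n\<close> is zero, so
      replacing \<open>g n\<close> by 0 does not change the class.\<close>
    moreover have "cls (if n \<in> ?N then g n else 0) = d n" for n
      by (auto simp: dg zero_L)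
    ultimately show "d = ?d" by auto
  qed
qed

text \<open>The grading, and with it one inclusion, always holds. The other inclusion passes from
  classes to polynomials because \<open>sprod\<close> is closed under congruence.\<close>

lemma strongly_graded_iff:
  "strongly_graded L (lpa_component G) \<longleftrightarrow> (\<forall>m n. hcomp G (m + n) \<subseteq> sprod m n)"
proof -
  have "lpa_component G (m + n) \<subseteq> set_prod L (lpa_component G m) (lpa_component G n)
      \<longleftrightarrow> hcomp G (m + n) \<subseteq> sprod m n" for m n
    unfolding set_prod_L unfolding lpa_component_eq
  proof (intro iffI subsetI)
    fix f :: "('v, 'e, 'r) lpa_poly"
    assume "cls ` hcomp G (m + n) \<subseteq> cls ` sprod m n" "f \<in> hcomp G (m + n)"
    then obtain g where "g \<in> sprod m n" "cls f = cls g" by blast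
    with \<open>f \<in> hcomp G (m + n)\<close> show "f \<in> sprod m n"
      using sprod_cong[of f g m n] by (simp add: lpa_class_eq_iff hcomp_in_F sprod_in_F)
  qed blast
  moreover have "set_prod L (lpa_component G m) (lpa_component G n) \<subseteq> lpa_component G (m + n)" for m n
    using graded_L unfolding graded_def by blast
  ultimately show ?thesis
    using graded_L unfolding strongly_graded_def by (simp add: set_eq_subset)
qed

end

section \<open>Sufficiency\<close>

context leavitt
begin

lemma gverts_subset_verts: "A \<in> gverts G \<Longrightarrow> A \<subseteq> verts G"
  by (induction rule: gverts.induct) (auto dest: rng_subset_verts)

lemma sprod_add:
  assumes "f \<in> sprod m n" "g \<in> sprod m n"
  shows "f + g \<in> sprod m n"
  using assms(1)
proof (induction rule: sprod.induct)
  case (ideal f)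
  then show ?case by (rule ideal_add_sprod) (rule assms(2))
next
  case (mult f a b)
  then have "f + g + a * b \<in> sprod m n" by (intro sprod.mult)
  then show ?case by (simp add: algebra_simps)
qed

lemma sprod_zero: "0 \<in> sprod m n"
  by (simp add: sprod.ideal ideal_zero)

lemma sprod_sum: "(\<And>i. i \<in> A \<Longrightarrow> f i \<in> sprod m n) \<Longrightarrow> sum f A \<in> sprod m n"
  by (induction A rule: infinite_finite_induct) (simp_all add: sprod_zero sprod_add)

lemma sprod_mult: "a \<in> hcomp G m \<Longrightarrow> b \<in> hcomp G n \<Longrightarrow> a * b \<in> sprod m n"
  using sprod.mult[OF sprod_zero] by simp

section \<open>Reduction to the projections\<close>

lemma sprod_mult_left:
  assumes "f \<in> sprod m n" "a \<in> hcomp G k"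
  shows "a * f \<in> sprod (k + m) n"
  using assms(1)
proof (induction rule: sprod.induct)
  case (ideal f)
  with assms(2) show ?case
    by (intro sprod.ideal ideal_mult_left) (rule hcomp_in_F)
next
  case (mult f b c)
  then have "a * f + a * b * c \<in> sprod (k + m) n"
    using assms(2) by (intro sprod.mult hcomp_mult)
  then show ?case by (simp add: algebra_simps)
qed

lemma sprod_mult_right:
  assumes "f \<in> sprod m n" "a \<in> hcomp G k"
  shows "f * a \<in> sprod m (n + k)"
  using assms(1)
proof (induction rule: sprod.induct)
  case (ideal f)
  with assms(2) show ?case
    by (intro sprod.ideal ideal_mult_right) (rule hcomp_in_F)
next
  case (mult f b c)
  then have "f * a + b * (c * a) \<in> sprod m (n + k)"
    using assms(2) by (intro sprod.mult hcomp_mult)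
  then show ?case by (simp add: algebra_simps)
qed

lemma gen_left_unit:
  assumes "x \<in> lpa_gens G"
  shows "\<exists>A\<in>gverts G. gP A * gen x \<sim> gen x"
proof (cases x)
  case (Edge e)
  with assms show ?thesis
    using eqv_src_S[of e] by (intro bexI[of _ "{src G e}"]) auto
next
  case (Ghost e)
  with assms show ?thesis
    using eqv_rng_S'[of e] by (intro bexI[of _ "rng G e"]) auto
next
  case (Proj A)
  with assms show ?thesis
    using eqv_P_P[of A A] by (intro bexI[of _ A]) auto
qed

text \<open>The first letter of a nonempty word is fixed by a projection on its left. This provides
  the local units.\<close>

lemma single_left_unit:
  assumes "set (letters w) \<subseteq> lpa_gens G" "w \<noteq> 0"
  shows "\<exists>A\<in>gverts G. gP A * Poly_Mapping.single w c \<sim> Poly_Mapping.single w c"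
proof -
  from assms(2) obtain x xs where w: "letters w = x # xs"
    by (cases "letters w") auto
  then have "w = Word [x] + Word xs"
    by (cases w) (simp add: plus_word_def)
  then have *: "Poly_Mapping.single w c = gen x * Poly_Mapping.single (Word xs) c"
    by (simp add: gen_mult_single)
  from assms w obtain A where A: "A \<in> gverts G" "gP A * gen x \<sim> gen x"
    using gen_left_unit[of x] by auto
  from A(2) have "gP A * gen x * Poly_Mapping.single (Word xs) c \<sim> gen x * Poly_Mapping.single (Word xs) c"
    by (rule eqv_multL) (use assms w in auto)
  with A(1) show ?thesis
    by (auto simp: * mult.assoc)
qed

text \<open>Each word \<open>s\<close> of \<open>f\<close> is congruent to \<open>gP A * s\<close>
  for a suitable \<open>A\<close>. The projection has the form of a sum of products of degrees
  \<open>k\<close> and \<open>- k\<close>, and \<open>s\<close> is multiplied into the right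
  factors.\<close>

lemma hcomp_subset_sprod:
  assumes "\<And>A. A \<in> gverts G \<Longrightarrow> gP A \<in> sprod k (- k)"
  shows "hcomp G n \<subseteq> sprod k (n - k)"
proof
  fix f :: "('v, 'e, 'r) lpa_poly"
  assume f: "f \<in> hcomp G n"
  have "(\<Sum>w\<in>Poly_Mapping.keys f. Poly_Mapping.single w (Poly_Mapping.lookup f w)) \<in> sprod k (n - k)"
  proof (rule sprod_sum)
    fix w assume "w \<in> Poly_Mapping.keys f"
    with f have w: "set (letters w) \<subseteq> lpa_gens G" "w \<noteq> 0" "word_deg w = n"
      by (auto simp: hcomp_def)
    let ?s = "Poly_Mapping.single w (Poly_Mapping.lookup f w)"
    from single_left_unit[OF w(1,2)] obtain A where A: "A \<in> gverts G" "gP A * ?s \<sim> ?s"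
      by blast
    have "gP A * ?s \<in> sprod k (- k + n)"
      using assms[OF A(1)] hcomp_single[OF w] by (rule sprod_mult_right)
    then show "?s \<in> sprod k (n - k)"
      using sprod_cong[OF eqv_sym[OF A(2)]] by simp
  qed
  then show "f \<in> sprod k (n - k)"
    by (simp flip: poly_mapping_eq_sum_single)
qed

text \<open>Each right factor, of degree \<open>n\<close>, is itself a sum of products of degrees
  \<open>k\<close> and \<open>n - k\<close>; the factors of degree \<open>k\<close> are then moved
  to the left.\<close>

lemma sprod_shift:
  assumes "f \<in> sprod m n" "\<And>A. A \<in> gverts G \<Longrightarrow> gP A \<in> sprod k (- k)"
  shows "f \<in> sprod (m + k) (n - k)"
  using assms(1)
proof (induction rule: sprod.induct)
  case (mult f a b)
  from mult.hyps(3) have "b \<in> sprod k (n - k)"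
    using hcomp_subset_sprod[OF assms(2)] by blast
  then have "a * b \<in> sprod (m + k) (n - k)"
    using mult.hyps(2) by (rule sprod_mult_left)
  with mult.IH show ?case by (rule sprod_add)
qed (rule sprod.ideal)

text \<open>Induction with \<open>sprod_shift\<close> carries the two memberships from the degrees 1
  and -1 to all degrees, and the local units carry them from the projections to all
  components.\<close>

lemma strongly_gradedI:
  assumes "\<And>A. A \<in> gverts G \<Longrightarrow> gP A \<in> sprod 1 (- 1)" "\<And>A. A \<in> gverts G \<Longrightarrow> gP A \<in> sprod (- 1) 1"
  shows "strongly_graded L (lpa_component G)"
proof -
  have 0: "gP A \<in> sprod 0 0" if "A \<in> gverts G" for A
    using sprod_cong[OF eqv_sym[OF eqv_P_P[OF that that]]] sprod_mult[OF hcomp_P hcomp_P] that by simp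
  have pos: "gP A \<in> sprod (int k) (- int k)" if "A \<in> gverts G" for A k
    using that
  proof (induction k arbitrary: A)
    case (Suc k)
    from sprod_shift[OF assms(1)[OF Suc.prems] Suc.IH] show ?case by simp
  qed (simp add: 0)
  have neg: "gP A \<in> sprod (- int k) (int k)" if "A \<in> gverts G" for A k
    using that
  proof (induction k arbitrary: A)
    case (Suc k)
    from sprod_shift[OF assms(2)[OF Suc.prems], of "- int k"] Suc.IH show ?case by simp
  qed (simp add: 0)
  have "gP A \<in> sprod m (- m)" if "A \<in> gverts G" for A m
    using pos[OF that, of "nat m"] neg[OF that, of "nat (- m)"] by (cases "m \<ge> 0") auto
  then have "hcomp G (m + n) \<subseteq> sprod m (m + n - m)" for m n
    by (rule hcomp_subset_sprod)
  then show ?thesis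
    by (simp add: strongly_graded_iff)
qed

section \<open>Vertex projections in products of components\<close>

lemma eqv_P_finite:
  assumes "finite A" "A \<subseteq> verts G"
  shows "gP A \<sim> (\<Sum>v\<in>A. gP {v})"
  using assms
proof (induction A rule: finite_induct)
  case empty
  then show ?case using eqv_P_empty by simp
next
  case (insert v A)
  then have A: "A \<in> gverts G" "{v} \<in> gverts G"
    by (simp_all add: finite_subset_in_gverts gverts.vertex)
  have "gP (insert v A) \<sim> gP {v} + gP A - gP ({v} \<inter> A)"
    using eqv_P_union[OF A(2,1)] by simp
  also have "\<dots> \<sim> gP {v} + (\<Sum>v\<in>A. gP {v}) - 0"
    using insert A by (intro eqv_diff eqv_add eqv_refl) (auto simp: eqv_P_empty)
  finally show ?case using insert by simp
qed

lemma row_finite_gverts_finite: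
  assumes "row_finite G" "A \<in> gverts G"
  shows "finite A"
  using assms(2) by (induction rule: gverts.induct) (use assms(1) in \<open>auto simp: row_finite_def\<close>)

lemma row_finite_P_in_sprod:
  assumes "row_finite G" "A \<in> gverts G" "\<And>v. v \<in> verts G \<Longrightarrow> gP {v} \<in> sprod m n"
  shows "gP A \<in> sprod m n"
proof (rule sprod_cong)
  show "gP A \<sim> (\<Sum>v\<in>A. gP {v})"
    using assms by (intro eqv_P_finite row_finite_gverts_finite gverts_subset_verts)
  show "(\<Sum>v\<in>A. gP {v}) \<in> sprod m n"
    using assms gverts_subset_verts by (intro sprod_sum) blast
qed

text \<open>The product telescopes from the inside: \<open>gS' e * gS e\<close> becomes
  \<open>gP (rng G e)\<close>, which the next edge absorbs because its source lies in that
  range.\<close>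

lemma eqv_sS'_sS:
  assumes "chain es" "es \<noteq> []"
  shows "sS' es * sS es \<sim> gP (rng G (last es))"
  using assms(2,1)
proof (induction es rule: list_nonempty_induct)
  case (single e)
  then show ?case using eqv_S'_S[of e e] by simp
next
  case (cons e es)
  then obtain f fs where es: "es = f # fs" "src G f \<in> rng G e"
    by (cases es) (auto simp: chain_Cons)
  from cons have e: "e \<in> edges G" "chain es" "set es \<subseteq> edges G" "f \<in> edges G" "set fs \<subseteq> edges G"
    using chain_edges[of es] by (auto simp: chain_Cons es)
  have "sS' (e # es) * sS (e # es) = sS' es * (gS' e * gS e) * sS es"
    by (simp add: mult.assoc)
  also have "\<dots> \<sim> sS' es * gP (rng G e) * sS es"
    using eqv_S'_S[of e e] e by (intro eqv_multL eqv_multR) simp_all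
  also have "\<dots> = sS' es * ((gP (rng G e) * gS f) * sS fs)"
    by (simp add: es mult.assoc)
  also have "\<dots> \<sim> sS' es * (gS f * sS fs)"
    using eqv_P_S[of "rng G e" f] e es(2) by (intro eqv_multL eqv_multR) simp_all
  also have "\<dots> = sS' es * sS es"
    by (simp add: es)
  also have "\<dots> \<sim> gP (rng G (last es))"
    using cons e by blast
  finally show ?case using cons by simp
qed

text \<open>A path \<open>fs\<close> with \<open>w \<in> r(fs)\<close> gives \<open>p\<^sub>w = p\<^sub>w s\<^sub>f\<^sub>s\<^sup>* s\<^sub>f\<^sub>s p\<^sub>w\<close>; if it is longer
  than \<open>es\<close> by one, this splits the monomial into factors of degrees -1 and 1.\<close>

lemma mon_in_sprod:
  assumes "set es \<subseteq> edges G" "chain fs" "length fs = Suc (length es)" "w \<in> rng G (last fs)"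
  shows "mon es {w} es \<in> sprod (- 1) 1"
proof -
  from assms have fs: "set fs \<subseteq> edges G" "fs \<noteq> []"
    using chain_edges[of fs] by auto
  then have r: "rng G (last fs) \<in> gverts G"
    using last_in_set by blast
  have w: "{w} \<in> gverts G"
    by (rule gverts.vertex) (use gverts_subset_verts[OF r] assms(4) in auto)
  have "gP {w} \<sim> gP ({w} \<inter> rng G (last fs)) * gP {w}"
    using eqv_sym[OF eqv_P_P[OF w w]] assms(4) by simp
  also have "\<dots> \<sim> gP {w} * gP (rng G (last fs)) * gP {w}"
    using w r by (intro eqv_multL eqv_sym[OF eqv_P_P]) auto
  also have "\<dots> \<sim> gP {w} * (sS' fs * sS fs) * gP {w}"
    using w fs assms(2) by (intro eqv_multL eqv_multR eqv_sym[OF eqv_sS'_sS]) auto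
  finally have "mon es {w} es \<sim> sS es * (gP {w} * (sS' fs * sS fs) * gP {w}) * sS' es"
    unfolding mon_def using assms(1) by (intro eqv_multL eqv_multR) auto
  also have "\<dots> = mon es {w} fs * mon fs {w} es"
    by (simp add: mon_def mult.assoc)
  finally show ?thesis
    by (rule sprod_cong)
      (use sprod_mult[OF hcomp_mon[OF assms(1) w fs(1)] hcomp_mon[OF fs(1) w assms(1)]] assms(3) in simp)
qed

text \<open>The branching step for Koenig's lemma. The relation for \<open>gP {w}\<close> and the
  finite ranges expand the monomial into a finite sum of monomials longer by one edge on both sides;
  if all of them were in \<open>sprod m n\<close>, so would be the sum.\<close>

lemma mon_split:
  assumes rf: "row_finite G" and ns: "\<forall>v \<in> verts G. \<not> sink G v"
    and es: "set es \<subseteq> edges G" and w: "w \<in> verts G"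
    and bad: "mon es {w} es \<notin> sprod m n"
  shows "\<exists>e u. e \<in> edges G \<and> src G e = w \<and> u \<in> rng G e \<and> mon (es @ [e]) {u} (es @ [e]) \<notin> sprod m n"
proof (rule ccontr)
  assume contr: "\<not> ?thesis"
  let ?E = "{e \<in> edges G. src G e = w}"
  have "gP {w} \<sim> (\<Sum>e\<in>?E. gS e * gS' e)"
    using rf ns w by (intro eqv_CK) (auto simp: row_finite_def)
  also have "\<dots> \<sim> (\<Sum>e\<in>?E. gS e * (\<Sum>u\<in>rng G e. gP {u}) * gS' e)"
  proof (rule eqv_sum)
    fix e assume "e \<in> ?E"
    then have e: "e \<in> edges G" by simp
    have "gS e * gS' e \<sim> gS e * gP (rng G e) * gS' e"
      using e by (intro eqv_multL eqv_sym[OF eqv_S_rng]) auto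
    also have "\<dots> \<sim> gS e * (\<Sum>u\<in>rng G e. gP {u}) * gS' e"
      using e rf by (intro eqv_multL eqv_multR eqv_P_finite)
        (auto simp: row_finite_def dest: rng_subset_verts)
    finally show "gS e * gS' e \<sim> gS e * (\<Sum>u\<in>rng G e. gP {u}) * gS' e" .
  qed
  finally have "mon es {w} es \<sim> sS es * (\<Sum>e\<in>?E. gS e * (\<Sum>u\<in>rng G e. gP {u}) * gS' e) * sS' es"
    unfolding mon_def using es by (intro eqv_multL eqv_multR) auto
  also have "\<dots> = (\<Sum>e\<in>?E. \<Sum>u\<in>rng G e. mon (es @ [e]) {u} (es @ [e]))"
    by (simp add: mon_def sum_distrib_left sum_distrib_right mult.assoc)
  also have "\<dots> \<in> sprod m n"
    using contr by (intro sprod_sum) blast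
  finally (sprod_cong) show False
    using bad by blast
qed

lemma sufficiency:
  assumes ns: "\<forall>v \<in> verts G. \<not> sink G v" and rf: "row_finite G" and Y: "condition_Y G"
  shows "strongly_graded L (lpa_component G)"
proof (rule strongly_gradedI)
  fix A assume "A \<in> gverts G"
  then show "gP A \<in> sprod 1 (- 1)"
  proof (rule row_finite_P_in_sprod[OF rf])
    fix v assume v: "v \<in> verts G"
    show "gP {v} \<in> sprod 1 (- 1)"
    proof (rule sprod_cong)
      show "gP {v} \<sim> (\<Sum>e \<in> {e \<in> edges G. src G e = v}. gS e * gS' e)"
        using rf ns v by (intro eqv_CK) (auto simp: row_finite_def)
      show "(\<Sum>e \<in> {e \<in> edges G. src G e = v}. gS e * gS' e) \<in> sprod 1 (- 1)"
        by (intro sprod_sum sprod_mult hcomp_gS hcomp_gS') auto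
    qed
  qed
next
  fix A assume "A \<in> gverts G"
  then show "gP A \<in> sprod (- 1) 1"
  proof (rule row_finite_P_in_sprod[OF rf])
    fix v assume v: "v \<in> verts G"
    show "gP {v} \<in> sprod (- 1) 1"
    proof (rule ccontr)
      assume *: "gP {v} \<notin> sprod (- 1) 1"
      \<comment> \<open>A state consists of the edges \<open>es\<close> chosen so far and the vertex
        \<open>w\<close> at which to continue. The relation \<open>ext\<close> puts the new vertex
        into the range of the appended edge, which turns the chosen edges into an infinite
        path.\<close>
      define bad where "bad = (\<lambda>(es, w). set es \<subseteq> edges G \<and> w \<in> verts G \<and> mon es {w} es \<notin> sprod (- 1) 1)"
      define ext where "ext = (\<lambda>(es, w) (es', u). \<exists>e. e \<in> edges G \<and> src G e = w \<and> u \<in> rng G e \<and> es' = es @ [e])"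
      have "\<exists>y. bad y \<and> ext x y" if "bad x" for x
      proof -
        obtain es w where x: "x = (es, w)" by (cases x)
        with that have b: "set es \<subseteq> edges G" "w \<in> verts G" "mon es {w} es \<notin> sprod (- 1) 1"
          by (auto simp: bad_def)
        from mon_split[OF rf ns b] obtain e u where "e \<in> edges G" "src G e = w" "u \<in> rng G e"
          "mon (es @ [e]) {u} (es @ [e]) \<notin> sprod (- 1) 1" by blast
        with b show ?thesis
          using rng_subset_verts[of e]
          by (intro exI[of _ "(es @ [e], u)"]) (auto simp: bad_def ext_def x simp del: sS_simps)
      qed
      moreover have "bad ([], v)"
        using * v by (simp add: bad_def mon_def)
      \<comment> \<open>Dependent choice; the clause for \<open>n = 0\<close> in its predicate pins
        down the initial state.\<close>
      ultimately obtain h where h0: "h 0 = ([], v)" and h: "\<And>k. bad (h k)" "\<And>k. ext (h k) (h (Suc k))"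
        using dependent_nat_choice[of "\<lambda>n x. bad x \<and> (n = 0 \<longrightarrow> x = ([], v))" "\<lambda>_. ext"] by (metis nat.distinct(1))
      define es w where "es k = fst (h k)" and "w k = snd (h k)" for k
      have "\<forall>k. \<exists>e. e \<in> edges G \<and> src G e = w k \<and> w (Suc k) \<in> rng G e \<and> es (Suc k) = es k @ [e]"
        using h(2) by (simp add: ext_def es_def w_def case_prod_beta)
      then obtain p where p: "\<And>k. p k \<in> edges G" "\<And>k. src G (p k) = w k" "\<And>k. w (Suc k) \<in> rng G (p k)"
        "\<And>k. es (Suc k) = es k @ [p k]"
        by metis
      \<comment> \<open>A witness for \<open>k\<close> in Condition (Y) has length
        \<open>k + 1\<close>, thus one more than \<open>es k\<close>, and its range contains the
        vertex \<open>w k\<close>.\<close>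
      have "length (es k) = k" for k
        by (induction k) (simp_all add: p(4), simp add: es_def h0)
      moreover have "infinite_path G p"
        using p by (simp add: infinite_path_def)
      then obtain k \<alpha> where "\<alpha> \<in> paths G" "path_length \<alpha> = k + 1" "src G (p k) \<in> path_rng G \<alpha>"
        using Y unfolding condition_Y_def by blast
      moreover from this obtain fs where "\<alpha> = EPath fs"
        by (cases \<alpha>) auto
      ultimately have "chain fs" "length fs = Suc (length (es k))" "w k \<in> rng G (last fs)"
        by (auto simp: paths_def is_path_EPath_iff p(2) simp del: is_path.simps(2))
      moreover have "set (es k) \<subseteq> edges G" "mon (es k) {w k} (es k) \<notin> sprod (- 1) 1"
        using h(1)[of k] by (auto simp: bad_def es_def w_def split: prod.splits)
      ultimately show False
        using mon_in_sprod by blast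
    qed
  qed
qed

end

section \<open>A representation on boundary paths\<close>

text \<open>Boundary paths are infinite paths and finite paths that end in a sink or an infinite emitter;
  the latter are made infinite by repeating the last vertex. The
  generators act on functions \<open>\<phi>\<close> on boundary paths through partial maps \<open>h\<close> of boundary paths,
  by \<open>\<phi> \<circ> h\<close>.\<close>

context ultragraph
begin

abbreviation singular :: "'v \<Rightarrow> bool" where
  "singular v \<equiv> sink G v \<or> infinite_emitter G v"

fun start :: "'e + 'v \<Rightarrow> 'v" where
  "start (Inl e) = src G e"
| "start (Inr v) = v"

definition bpath :: "(nat \<Rightarrow> 'e + 'v) \<Rightarrow> bool" where
  "bpath x \<longleftrightarrow> (\<forall>i. case x i of
      Inl e \<Rightarrow> e \<in> edges G \<and> start (x (Suc i)) \<in> rng G e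
    | Inr v \<Rightarrow> v \<in> verts G \<and> singular v \<and> x (Suc i) = Inr v)"

lemma bpath_shift: "bpath x \<Longrightarrow> bpath (\<lambda>i. x (Suc i))"
  unfolding bpath_def by blast

lemma bpath_Inl: "bpath x \<Longrightarrow> x i = Inl e \<Longrightarrow> e \<in> edges G \<and> start (x (Suc i)) \<in> rng G e"
  unfolding bpath_def by (drule spec[of _ i]) simp

lemma bpath_Inr: "bpath x \<Longrightarrow> x i = Inr v \<Longrightarrow> v \<in> verts G \<and> singular v"
  unfolding bpath_def by (drule spec[of _ i]) simp

lemma bpath_cons:
  "bpath x \<Longrightarrow> e \<in> edges G \<Longrightarrow> start (x 0) \<in> rng G e \<Longrightarrow> bpath (case_nat (Inl e) x)"
  unfolding bpath_def by (simp split: nat.split)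

text \<open>The path runs along chosen edges until it possibly reaches a singular vertex, which it
  then repeats forever.\<close>

lemma ex_bpath:
  assumes "v \<in> verts G"
  shows "\<exists>x. bpath x \<and> start (x 0) = v"
proof -
  define emit where "emit v = (if singular v then Inr v else Inl (SOME e. e \<in> edges G \<and> src G e = v))" for v
  define nxt where "nxt a = (case a of Inl e \<Rightarrow> emit (SOME v. v \<in> rng G e) | Inr v \<Rightarrow> Inr v)" for a :: "'e + 'v"
  define good where "good a = (case a of Inl e \<Rightarrow> e \<in> edges G | Inr v \<Rightarrow> v \<in> verts G \<and> singular v)"
    for a :: "'e + 'v"
  define x where "x i = (nxt ^^ i) (emit v)" for i
  have emit: "good (emit v) \<and> start (emit v) = v" if "v \<in> verts G" for v
  proof (cases "singular v")
    case False
    then have "\<exists>e. e \<in> edges G \<and> src G e = v"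
      by (auto simp: sink_def)
    from someI_ex[OF this] False show ?thesis
      by (simp add: emit_def good_def)
  qed (use that in \<open>simp add: emit_def good_def\<close>)
  have rng: "(SOME v. v \<in> rng G e) \<in> rng G e" if "e \<in> edges G" for e
    using rng_nonempty[OF that] by (simp add: some_in_eq)
  have nxt: "good (nxt a) \<and> (case a of Inl e \<Rightarrow> start (nxt a) \<in> rng G e | Inr v \<Rightarrow> nxt a = Inr v)"
    if "good a" for a
  proof (cases a)
    case (Inl e)
    with that have e: "e \<in> edges G" by (simp add: good_def)
    have "(SOME v. v \<in> rng G e) \<in> verts G"
      using rng[OF e] rng_subset_verts[OF e] by blast
    from emit[OF this] rng[OF e] show ?thesis
      by (simp add: Inl nxt_def)
  qed (use that in \<open>simp add: nxt_def good_def\<close>)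
  have good: "good (x i)" for i
    by (induction i) (use emit[OF assms] nxt in \<open>simp_all add: x_def\<close>)
  have "x (Suc i) = nxt (x i)" for i
    by (simp add: x_def)
  then have "case x i of Inl e \<Rightarrow> e \<in> edges G \<and> start (x (Suc i)) \<in> rng G e
      | Inr v \<Rightarrow> v \<in> verts G \<and> singular v \<and> x (Suc i) = Inr v" for i
    using good[of i] nxt[OF good[of i]] by (cases "x i") (simp_all add: good_def)
  then have "bpath x"
    unfolding bpath_def by blast
  moreover have "start (x 0) = v"
    using emit[OF assms] by (simp add: x_def)
  ultimately show ?thesis by blast
qed

text \<open>The maps point opposite to the action, because functions are composed with them:
  \<open>Edge e\<close> removes \<open>e\<close>, so that \<open>gS e\<close> sends the indicator of
  a boundary path starting in \<open>rng G e\<close> to the indicator of that path preceded by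
  \<open>e\<close>.\<close>

fun gen_map :: "('v, 'e) lpa_gen \<Rightarrow> (nat \<Rightarrow> 'e + 'v) \<Rightarrow> (nat \<Rightarrow> 'e + 'v) option" where
  "gen_map (Edge e) x = (if bpath x \<and> x 0 = Inl e then Some (\<lambda>i. x (Suc i)) else None)"
| "gen_map (Ghost e) x =
    (if bpath x \<and> e \<in> edges G \<and> start (x 0) \<in> rng G e then Some (case_nat (Inl e) x) else None)"
| "gen_map (Proj A) x = (if bpath x \<and> start (x 0) \<in> A then Some x else None)"

text \<open>The map of the first letter is applied first. Composing functions with these maps
  reverses the order, which makes the action of words a left action.\<close>

fun word_map :: "('v, 'e) lpa_gen list \<Rightarrow> (nat \<Rightarrow> 'e + 'v) \<Rightarrow> (nat \<Rightarrow> 'e + 'v) option" where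
  "word_map [] x = Some x"
| "word_map (g # gs) x = Option.bind (gen_map g x) (word_map gs)"

lemma word_map_append: "word_map (us @ vs) x = Option.bind (word_map us x) (word_map vs)"
  by (induction us arbitrary: x) (auto simp: bind_eq_None_conv split: Option.bind_splits)

end

context leavitt
begin

definition wact :: "('v, 'e) lpa_gen word \<Rightarrow> ((nat \<Rightarrow> 'e + 'v) \<Rightarrow> 'r) \<Rightarrow> (nat \<Rightarrow> 'e + 'v) \<Rightarrow> 'r" where
  "wact w \<phi> x = (case word_map (letters w) x of None \<Rightarrow> 0 | Some y \<Rightarrow> \<phi> y)"

definition act :: "('v, 'e, 'r) lpa_poly \<Rightarrow> ((nat \<Rightarrow> 'e + 'v) \<Rightarrow> 'r) \<Rightarrow> (nat \<Rightarrow> 'e + 'v) \<Rightarrow> 'r" where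
  "act f \<phi> x = (\<Sum>w\<in>Poly_Mapping.keys f. Poly_Mapping.lookup f w * wact w \<phi> x)"

lemma wact_add: "wact (u + v) \<phi> = wact u (wact v \<phi>)"
  by (rule ext) (simp add: wact_def word_map_append split: option.split)

lemma wact_sum: "wact w (\<lambda>x. \<Sum>i\<in>A. \<phi> i x) x = (\<Sum>i\<in>A. wact w (\<phi> i) x)"
  by (simp add: wact_def split: option.split)

lemma wact_scale: "wact w (\<lambda>x. c * \<phi> x) x = c * wact w \<phi> x"
  by (simp add: wact_def split: option.split)

lemma act_zero [simp]: "act 0 \<phi> x = 0"
  by (simp add: act_def)

lemma act_null [simp]: "act f (\<lambda>_. 0) = (\<lambda>_. 0)"
  by (rule ext) (auto simp: act_def wact_def split: option.split intro!: sum.neutral)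

lemma act_add: "act (f + g) \<phi> x = act f \<phi> x + act g \<phi> x"
  unfolding act_def by (rule setsum_keys_plus_distrib) (simp_all add: distrib_right)

lemma act_sum: "act (sum f A) \<phi> x = (\<Sum>i\<in>A. act (f i) \<phi> x)"
  by (induction A rule: infinite_finite_induct) (simp_all add: act_add)

lemma act_diff: "act (f - g) \<phi> x = act f \<phi> x - act g \<phi> x"
  using act_add[of "f - g" g \<phi> x] by simp

lemma act_single: "act (Poly_Mapping.single w c) \<phi> x = c * wact w \<phi> x"
  by (simp add: act_def)

lemma act_mult: "act (f * g) \<phi> = act f (act g \<phi>)"
proof (rule ext)
  fix x
  have "act ((\<Sum>u\<in>A. Poly_Mapping.single u (a u)) * (\<Sum>v\<in>B. Poly_Mapping.single v (b v))) \<phi> x =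
      act (\<Sum>u\<in>A. Poly_Mapping.single u (a u)) (act (\<Sum>v\<in>B. Poly_Mapping.single v (b v)) \<phi>) x"
    for A B a b
  proof -
    have "act (\<Sum>v\<in>B. Poly_Mapping.single v (b v)) \<phi> = (\<lambda>y. \<Sum>v\<in>B. b v * wact v \<phi> y)"
      by (rule ext) (simp add: act_sum act_single)
    then show ?thesis
      by (simp add: act_sum act_single sum_distrib_left sum_distrib_right mult_single wact_sum
          wact_scale wact_add mult.assoc) (rule sum.swap)
  qed
  from this[where A = "Poly_Mapping.keys f" and a = "Poly_Mapping.lookup f"
      and B = "Poly_Mapping.keys g" and b = "Poly_Mapping.lookup g"]
  show "act (f * g) \<phi> x = act f (act g \<phi>) x"
    by (simp only: poly_mapping_eq_sum_single[symmetric])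
qed

lemma act_scal_mult: "act (scal c * f) \<phi> x = c * act f \<phi> x"
  by (simp add: act_mult scal_def act_single wact_def)

lemma act_gen: "act (gen a) \<phi> x = (case gen_map a x of None \<Rightarrow> 0 | Some y \<Rightarrow> \<phi> y)"
  by (auto simp: gen_def act_single wact_def split: option.split Option.bind_split)

lemma act_gens:
  "act (gS e) \<phi> x = (if bpath x \<and> x 0 = Inl e then \<phi> (\<lambda>i. x (Suc i)) else 0)"
  "act (gS' e) \<phi> x =
    (if bpath x \<and> e \<in> edges G \<and> start (x 0) \<in> rng G e then \<phi> (case_nat (Inl e) x) else 0)"
  "act (gP A) \<phi> x = (if bpath x \<and> start (x 0) \<in> A then \<phi> x else 0)"
  by (simp_all add: act_gen)

lemma act_gens_mult:
  "act (gS e * f) \<phi> x = (if bpath x \<and> x 0 = Inl e then act f \<phi> (\<lambda>i. x (Suc i)) else 0)"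
  "act (gS' e * f) \<phi> x =
    (if bpath x \<and> e \<in> edges G \<and> start (x 0) \<in> rng G e then act f \<phi> (case_nat (Inl e) x) else 0)"
  "act (gP A * f) \<phi> x = (if bpath x \<and> start (x 0) \<in> A then act f \<phi> x else 0)"
  by (simp_all only: act_mult act_gens)

lemma case_nat_shift: "x 0 = a \<Longrightarrow> case_nat a (\<lambda>i. x (Suc i)) = x"
  by (rule ext) (simp split: nat.split)

text \<open>The relation that expands \<open>gP {v}\<close> holds because a boundary path that
  starts at a vertex which is not singular begins with exactly one of the edges emitted there. For
  the other relations the maps are compared directly.\<close>

lemma act_relation:
  fixes f :: "('v, 'e, 'r) lpa_poly"
  assumes "f \<in> lpa_relations G"
  shows "act f \<phi> x = 0"
proof -
  have CK: "act (gP {v} - (\<Sum>e \<in> {e \<in> edges G. src G e = v}. gS e * gS' e)) \<phi> x = 0"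
    if "v \<in> verts G" "\<not> sink G v" "\<not> infinite_emitter G v" for v
  proof -
    let ?E = "{e \<in> edges G. src G e = v}"
    have fin: "finite ?E"
      using that by (simp add: infinite_emitter_def)
    have "act (\<Sum>e\<in>?E. gS e * gS' e) \<phi> x = (\<Sum>e\<in>?E. if bpath x \<and> x 0 = Inl e then \<phi> x else 0)"
      unfolding act_sum
      by (rule sum.cong)
        (auto simp: act_gens_mult act_gens case_nat_shift bpath_shift dest: bpath_Inl)
    also have "\<dots> = (if bpath x \<and> start (x 0) = v then \<phi> x else 0)"
    proof (cases "x 0")
      case (Inl e)
      then have "(\<Sum>e\<in>?E. if bpath x \<and> x 0 = Inl e then \<phi> x else 0) =
          (\<Sum>e'\<in>?E. if e = e' then (if bpath x then \<phi> x else 0) else 0)"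
        by (intro sum.cong) auto
      with fin Inl show ?thesis
        using bpath_Inl[of x 0 e] by (auto simp: sum.delta)
    next
      \<comment> \<open>On a boundary path \<open>w\<close> is singular and hence different from
        \<open>v\<close>, so both sides are 0.\<close>
      case (Inr w)
      then show ?thesis
        using bpath_Inr[of x 0 w] that by auto
    qed
    finally show ?thesis
      by (simp add: act_diff act_gens)
  qed
  have "act (gS' e * gS e' - (if e = e' then gP (rng G e) else 0)) \<phi> x = 0"
    if "e \<in> edges G" "e' \<in> edges G" for e e'
    using that by (auto simp: act_diff act_gens act_gens_mult bpath_cons)
  moreover have "act (gP {}) \<phi> x = 0"
    by (simp add: act_gens)
  moreover have "act (gP A * gP B - gP (A \<inter> B)) \<phi> x = 0"
    "act (gP (A \<union> B) - (gP A + gP B - gP (A \<inter> B))) \<phi> x = 0" for A B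
    by (auto simp: act_diff act_add act_gens act_gens_mult)
  moreover have "act (gP {src G e} * gS e - gS e) \<phi> x = 0" "act (gS e * gP (rng G e) - gS e) \<phi> x = 0"
    "act (gP (rng G e) * gS' e - gS' e) \<phi> x = 0" "act (gS' e * gP {src G e} - gS' e) \<phi> x = 0"
    if "e \<in> edges G" for e
    using that by (auto simp: act_diff act_gens act_gens_mult bpath_shift bpath_cons dest: bpath_Inl)
  ultimately show ?thesis
    using assms CK unfolding lpa_relations_def Un_iff mem_Collect_eq singleton_iff
    by (elim disjE exE conjE; hypsubst) blast+
qed

lemma act_ideal:
  assumes "f \<in> I"
  shows "act f \<phi> x = 0"
proof -
  have "\<forall>\<phi>. act f \<phi> = (\<lambda>_. 0)"
    using assms
  proof (induction rule: lpa_ideal_induct)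
    case (mult_left a f)
    then have "act f \<phi> = (\<lambda>_. 0)" for \<phi> by blast
    then show ?case by (simp add: act_mult)
  qed (simp_all add: act_relation act_add act_mult fun_eq_iff)
  then show ?thesis by simp
qed


section \<open>Necessity\<close>

text \<open>Since monomials span modulo the ideal, and the ideal acts as 0, it suffices to test
  monomials.\<close>

lemma act_hcomp_zero:
  assumes "b \<in> hcomp G n"
    and "\<And>es B fs y. chain es \<Longrightarrow> B \<in> gverts G \<Longrightarrow> chain fs \<Longrightarrow>
      int (length es) - int (length fs) = n \<Longrightarrow> act (mon es B fs) \<phi> y = 0"
  shows "act b \<phi> y = 0"
proof -
  have "b \<in> mspan n"
    using assms(1) hcomp_subset_mspan by blast
  then show ?thesis
  proof (induction rule: mspan.induct)
    case (mon f es B fs c)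
    then show ?case
      using assms(2)[of es B fs y] by (simp add: act_add act_scal_mult)
  qed (rule act_ideal)
qed

text \<open>The ideal acts as 0, and in each product the right factor is the first to act on
  \<open>\<phi>\<close>.\<close>

lemma act_sprod_zero:
  assumes "f \<in> sprod m n" "\<And>b y. b \<in> hcomp G n \<Longrightarrow> act b \<phi> y = 0"
  shows "act f \<phi> y = 0"
  using assms(1)
proof (induction rule: sprod.induct)
  case (mult f a b)
  then have "act b \<phi> = (\<lambda>_. 0)"
    using assms(2) by blast
  with mult show ?case by (simp add: act_add act_mult)
qed (rule act_ideal)

text \<open>The test function is the indicator of the constant boundary path at \<open>v\<close>. A
  monomial of degree -1 ends with a ghost edge, which evaluates its argument only at paths that
  begin with an edge.\<close>

lemma not_singular:
  assumes "v \<in> verts G" "gP {v} \<in> sprod m (- 1)"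
  shows "\<not> singular v"
proof
  assume v: "singular v"
  define x :: "nat \<Rightarrow> 'e + 'v" where "x = (\<lambda>_. Inr v)"
  define \<phi> :: "(nat \<Rightarrow> 'e + 'v) \<Rightarrow> 'r" where "\<phi> y = (if y = x then 1 else 0)" for y
  have "act b \<phi> y = 0" if "b \<in> hcomp G (- 1)" for b y
    using that
  proof (rule act_hcomp_zero)
    fix es fs :: "'e list" and B and y :: "nat \<Rightarrow> 'e + 'v"
    assume "int (length es) - int (length fs) = - 1"
    then obtain e fs' where fs: "fs = e # fs'"
      by (cases fs) auto
    have "case_nat (Inl e) y \<noteq> x" for y :: "nat \<Rightarrow> 'e + 'v"
    proof
      assume "case_nat (Inl e) y = x"
      from fun_cong[OF this, of 0] show False by (simp add: x_def)
    qed
    then have "act (gS' e) \<phi> = (\<lambda>_. 0)"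
      by (auto simp: act_gens \<phi>_def)
    then show "act (mon es B fs) \<phi> y = 0"
      by (simp add: mon_def fs act_mult)
  qed
  then have "act (gP {v}) \<phi> x = 0"
    by (rule act_sprod_zero[OF assms(2)])
  moreover have "bpath x"
    using assms(1) v by (simp add: bpath_def x_def)
  \<comment> \<open>The value is also 1, which differs from 0 because the ring of scalars is
    nonzero.\<close>
  ultimately show False
    by (simp add: act_gens \<phi>_def x_def)
qed

section \<open>Finiteness of the ranges\<close>

lemma mspan_first_edge:
  assumes "f \<in> mspan n" "n > 0"
  shows "\<exists>S. finite S \<and> (\<forall>\<phi> x. x 0 \<notin> Inl ` S \<longrightarrow> act f \<phi> x = 0)"
  using assms(1)
proof (induction rule: mspan.induct)
  case (ideal f)
  then show ?case
    by (intro exI[of _ "{}"]) (simp add: act_ideal)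
next
  case (mon f es B fs c)
  then obtain S where S: "finite S" "\<And>\<phi> x. x 0 \<notin> Inl ` S \<Longrightarrow> act f \<phi> x = 0" by blast
  \<comment> \<open>A positive degree forces \<open>es\<close> to be nonempty, and the monomial only
    yields functions supported on paths that begin with its first edge.\<close>
  from mon assms(2) obtain e es' where es: "es = e # es'"
    by (cases es) auto
  have "act (mon es B fs) \<phi> x = 0" if "x 0 \<noteq> Inl e" for \<phi> x
    using that by (simp add: mon_def es mult.assoc act_gens_mult)
  with S show ?case
    by (intro exI[of _ "insert e S"])
      (auto simp: act_add act_scal_mult)
qed

text \<open>The left factors act last, so the image is supported on the union of the supports that
  belong to the finitely many left factors.\<close>

lemma sprod_first_edge:
  assumes "f \<in> sprod m n" "m > 0"
  shows "\<exists>S. finite S \<and> (\<forall>\<phi> x. x 0 \<notin> Inl ` S \<longrightarrow> act f \<phi> x = 0)"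
  using assms(1)
proof (induction rule: sprod.induct)
  case (ideal f)
  then show ?case
    by (intro exI[of _ "{}"]) (simp add: act_ideal)
next
  case (mult f a b)
  then obtain S where S: "finite S" "\<And>\<phi> x. x 0 \<notin> Inl ` S \<Longrightarrow> act f \<phi> x = 0" by blast
  from mult.hyps(2) have "a \<in> mspan m"
    using hcomp_subset_mspan by blast
  from mspan_first_edge[OF this assms(2)]
  obtain S' where "finite S'" "\<And>\<phi> x. x 0 \<notin> Inl ` S' \<Longrightarrow> act a \<phi> x = 0" by blast
  with S show ?case
    by (intro exI[of _ "S \<union> S'"]) (auto simp: act_add act_mult image_Un)
qed

text \<open>Each vertex of \<open>A\<close> is the start of a boundary path, at which
  \<open>gP A\<close> applied to the constant function 1 is nonzero. The first entry of that path is
  therefore an edge in \<open>S\<close> whose source is the given vertex.\<close>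

lemma finite_gvert:
  assumes "A \<in> gverts G" "A \<subseteq> verts G" "gP A \<in> sprod m n" "m > 0"
  shows "finite A"
proof -
  from sprod_first_edge[OF assms(3,4)] obtain S
    where S: "finite S" "\<And>\<phi> x. x 0 \<notin> Inl ` S \<Longrightarrow> act (gP A) \<phi> x = 0" by blast
  have "A \<subseteq> src G ` S"
  proof
    fix v assume v: "v \<in> A"
    with assms(2) ex_bpath obtain x where x: "bpath x" "start (x 0) = v" by blast
    then have "act (gP A) (\<lambda>_. 1) x \<noteq> 0"
      using v by (simp add: act_gens)
    with S(2) have "x 0 \<in> Inl ` S" by blast
    with x(2) show "v \<in> src G ` S" by auto
  qed
  with S(1) show ?thesis
    using finite_surj by blast
qed

section \<open>Condition (Y)\<close>

lemma act_sS_nonzero: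
  "act (sS es) \<phi> x \<noteq> 0 \<Longrightarrow> es \<noteq> [] \<Longrightarrow>
    \<phi> (\<lambda>i. x (i + length es)) \<noteq> 0 \<and> start (x (length es)) \<in> rng G (last es)"
proof (induction es arbitrary: x)
  case (Cons e es)
  from Cons.prems have x: "bpath x" "x 0 = Inl e" "act (sS es) \<phi> (\<lambda>i. x (Suc i)) \<noteq> 0"
    by (auto simp: act_gens_mult split: if_splits)
  show ?case
  proof (cases "es = []")
    case True
    with x bpath_Inl[OF x(1,2)] show ?thesis
      by (simp add: act_def wact_def)
  next
    case False
    with Cons.IH[OF x(3)] show ?thesis by simp
  qed
qed simp

text \<open>Ghost edges prepend: a nonzero value at \<open>x\<close> is the value of
  \<open>\<phi>\<close> at \<open>x\<close> preceded by \<open>fs\<close>. The last edge of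
  \<open>fs\<close> is prepended first, hence the induction from the end of the list.\<close>

lemma act_sS'_nonzero:
  "act (sS' fs) \<phi> x \<noteq> 0 \<Longrightarrow> \<exists>z. \<phi> z \<noteq> 0 \<and> x = (\<lambda>i. z (i + length fs))"
proof (induction fs arbitrary: x rule: rev_induct)
  case Nil
  then show ?case by (auto simp: act_def wact_def)
next
  case (snoc e fs)
  then have "act (sS' fs) \<phi> (case_nat (Inl e) x) \<noteq> 0"
    by (auto simp: act_gens_mult split: if_splits)
  from snoc.IH[OF this] obtain z where z: "\<phi> z \<noteq> 0" "case_nat (Inl e) x = (\<lambda>i. z (i + length fs))"
    by blast
  have "x i = z (i + length (fs @ [e]))" for i
    using fun_cong[OF z(2), of "Suc i"] by simp
  with z(1) show ?case by blast
qed

text \<open>If a monomial of degree 1 does not kill the indicator of the infinite path, then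
  removing \<open>es\<close> from \<open>y\<close> and the first \<open>length fs\<close> edges from
  \<open>p\<close> leaves the same tail. Hence the source of \<open>p (length fs)\<close> lies in
  the range of \<open>es\<close>, and \<open>es\<close>, of length \<open>length fs + 1\<close>, is
  a witness for \<open>k = length fs\<close>.\<close>

lemma condition_Y_at:
  assumes "infinite_path G p" "gP {src G (p 0)} \<in> sprod m 1"
  shows "\<exists>k. \<exists>\<alpha> \<in> paths G. path_length \<alpha> = k + 1 \<and> src G (p k) \<in> path_rng G \<alpha>"
proof (rule ccontr)
  assume contr: "\<not> ?thesis"
  define x :: "nat \<Rightarrow> 'e + 'v" where "x i = Inl (p i)" for i
  define \<phi> :: "(nat \<Rightarrow> 'e + 'v) \<Rightarrow> 'r" where "\<phi> y = (if y = x then 1 else 0)" for y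
  have "act b \<phi> y = 0" if "b \<in> hcomp G 1" for b y
    using that
  proof (rule act_hcomp_zero)
    fix es fs :: "'e list" and B and y :: "nat \<Rightarrow> 'e + 'v"
    assume es: "chain es" "int (length es) - int (length fs) = 1"
    show "act (mon es B fs) \<phi> y = 0"
    proof (rule ccontr)
      assume nz: "act (mon es B fs) \<phi> y \<noteq> 0"
      from es have ne: "es \<noteq> []" "length es = length fs + 1" by auto
      from nz have "act (sS es) (act (gP B * sS' fs) \<phi>) y \<noteq> 0"
        by (simp add: mon_def mult.assoc act_mult)
      from act_sS_nonzero[OF this ne(1)]
      have "act (sS' fs) \<phi> (\<lambda>i. y (i + length es)) \<noteq> 0" and r: "start (y (length es)) \<in> rng G (last es)"
        by (auto simp: act_gens_mult split: if_splits)
      from act_sS'_nonzero[OF this(1)] have "(\<lambda>i. y (i + length es)) = (\<lambda>i. x (i + length fs))"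
        by (auto simp: \<phi>_def split: if_splits)
      from fun_cong[OF this, of 0] r have "src G (p (length fs)) \<in> path_rng G (EPath es)"
        by (simp add: x_def)
      moreover have "EPath es \<in> paths G" "path_length (EPath es :: ('v, 'e) upath) = length fs + 1"
        using es(1) ne by (simp_all add: paths_def is_path_EPath_iff del: is_path.simps(2))
      ultimately show False
        using contr by blast
    qed
  qed
  then have "act (gP {src G (p 0)}) \<phi> x = 0"
    by (rule act_sprod_zero[OF assms(2)])
  moreover have "bpath x"
    using assms(1) by (simp add: bpath_def x_def infinite_path_def)
  ultimately show False
    by (simp add: act_gens \<phi>_def x_def)
qed

lemma necessity:
  assumes "strongly_graded L (lpa_component G)"
  shows "(\<forall>v \<in> verts G. \<not> sink G v) \<and> row_finite G \<and> condition_Y G"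
proof -
  have P: "gP A \<in> sprod m (- m)" if "A \<in> gverts G" for A m
  proof -
    have "hcomp G (m + - m) \<subseteq> sprod m (- m)"
      using assms unfolding strongly_graded_iff by blast
    with hcomp_P[OF that] show ?thesis by auto
  qed
  have "\<not> singular v" if "v \<in> verts G" for v
    using not_singular[OF that P[OF gverts.vertex[OF that], of 1]] .
  moreover have "finite (rng G e)" if "e \<in> edges G" for e
    using finite_gvert[OF gverts.rng[OF that] rng_subset_verts[OF that] P[OF gverts.rng[OF that], of 1]]
    by simp
  moreover have "condition_Y G"
    unfolding condition_Y_def
  proof (intro allI impI)
    fix p assume p: "infinite_path G p"
    then have "p 0 \<in> edges G"
      by (simp add: infinite_path_def)
    then have "gP {src G (p 0)} \<in> sprod (- 1) 1"
      using P[of "{src G (p 0)}" "- 1"] by simp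
    with p show "\<exists>k. \<exists>\<alpha>\<in>paths G. path_length \<alpha> = k + 1 \<and> src G (p k) \<in> path_rng G \<alpha>"
      by (rule condition_Y_at)
  qed
  ultimately show ?thesis
    unfolding row_finite_def by blast
qed

end

theorem theorem3p9:
  fixes G :: "('v, 'e) pre_ultragraph"
  assumes "ultragraph G"
  shows "strongly_graded
      (lpa G :: ('v, 'e, 'r::comm_ring_1) lpa_poly set ring)
      (lpa_component G)
    \<longleftrightarrow>
      (\<forall>v \<in> verts G. \<not> sink G v) \<and> row_finite G \<and> condition_Y G"
proof -
  interpret leavitt G "TYPE('r)"
    using assms by (simp add: leavitt_def)
  show ?thesis
    using necessity sufficiency by blast
qed

end
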